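(* Let $\ell\ge1$, let $x$ be a product of two $\ell$-bit primes, and let $k\ge1$ and $e_0,e_1,\dots,e_k\ge1$ be integers such that the least common multiple of $2^{e_0}$, $2^{e_1}-1,\dots,2^{e_k}-1$, $2^{e_1}+1,\dots,2^{e_k}+1$ is at least $2^{2\ell}$. For $1\le i\le k$ let $\ell'_i=\ell-(\ell\bmod e_i)$, and let \[ N=\sum_{i=1}^k(6e_i^2+19e_i+2\ell'_i)+\tfrac32e_0^2-\tfrac12e_0+4k\ell+k+2\ell-2 . \] Then one can construct a formula $F$ in extended 4-conjunctive form, with at most $N$ variables and at most $N$ clauses, whose variables include $2\ell$ variables encoding two $\ell$-bit numbers $u,v$ in binary, such that for all $\ell$-bit numbers $u,v$: $u\cdot v=x$ if and only if the corresponding assignment to these $2\ell$ variables can be extended to a satisfying assignment of $F$. Moreover, $F$ can be expressed in 4-conjunctive normal form with at most \[ \sum_{i=1}^k(40e_i^2+88e_i+8\ell'_i)+10e_0^2-6e_0+32k\ell+8k-8 \] clauses.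
   Context: An $\ell$-bit number is an integer in $\{0,\dots,2^\ell-1\}$; an $\ell$-bit prime is a prime that is an $\ell$-bit number with leading bit 1. A formula in extended 4-conjunctive form is a conjunction of clauses each of which is an arbitrary Boolean constraint on at most 4 variables. A formula in 4-conjunctive normal form is a conjunction of ordinary clauses (disjunctions of literals) each with at most 4 literals. *)

theory Defs
  imports Complex_Main "HOL-Computational_Algebra.Primes"
begin

section \<open>Numbers\<close>

definition bit_number :: "nat \<Rightarrow> nat \<Rightarrow> bool" where
  "bit_number l u \<longleftrightarrow> u < 2 ^ l"

definition bit_prime :: "nat \<Rightarrow> nat \<Rightarrow> bool" where
  "bit_prime l p \<longleftrightarrow> prime p \<and> bit_number l p \<and> bit p (l - 1)"

section \<open>Formulas\<close>

text \<open>
  An arbitrary Boolean constraint is a pair of its set of variables and a predicate on assignments;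
  the predicate may depend on the listed variables only (\<^term>\<open>on_vars\<close>). A formula is the list of
  its clauses, so its number of clauses is the length of the list.
\<close>

type_synonym 'v assignment = "'v \<Rightarrow> bool"
type_synonym 'v ext_clause = "'v set \<times> ('v assignment \<Rightarrow> bool)"
type_synonym 'v ext_formula = "'v ext_clause list"

definition on_vars :: "'v set \<Rightarrow> ('v assignment \<Rightarrow> bool) \<Rightarrow> bool" where
  "on_vars S P \<longleftrightarrow> (\<forall>\<sigma> \<tau>. (\<forall>y\<in>S. \<sigma> y = \<tau> y) \<longrightarrow> P \<sigma> = P \<tau>)"

definition ext_conjunctive_form :: "nat \<Rightarrow> 'v ext_formula \<Rightarrow> bool" where
  "ext_conjunctive_form r F \<longleftrightarrow> (\<forall>(S, P) \<in> set F. finite S \<and> card S \<le> r \<and> on_vars S P)"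

definition ext_vars :: "'v ext_formula \<Rightarrow> 'v set" where
  "ext_vars F = (\<Union>(S, P) \<in> set F. S)"

definition ext_sat :: "'v assignment \<Rightarrow> 'v ext_formula \<Rightarrow> bool" where
  "ext_sat \<sigma> F \<longleftrightarrow> (\<forall>(S, P) \<in> set F. P \<sigma>)"

datatype 'v literal = Pos 'v | Neg 'v

type_synonym 'v cnf = "'v literal list list"

fun literal_var :: "'v literal \<Rightarrow> 'v" where
  "literal_var (Pos y) = y"
| "literal_var (Neg y) = y"

fun literal_sat :: "'v assignment \<Rightarrow> 'v literal \<Rightarrow> bool" where
  "literal_sat \<sigma> (Pos y) = \<sigma> y"
| "literal_sat \<sigma> (Neg y) = (\<not> \<sigma> y)"

definition conjunctive_normal_form :: "nat \<Rightarrow> 'v cnf \<Rightarrow> bool" where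
  "conjunctive_normal_form r G \<longleftrightarrow> (\<forall>C\<in>set G. length C \<le> r)"

definition cnf_vars :: "'v cnf \<Rightarrow> 'v set" where
  "cnf_vars G = (\<Union>C\<in>set G. literal_var ` set C)"

definition cnf_sat :: "'v assignment \<Rightarrow> 'v cnf \<Rightarrow> bool" where
  "cnf_sat \<sigma> G \<longleftrightarrow> (\<forall>C\<in>set G. \<exists>a\<in>set C. literal_sat \<sigma> a)"

definition expressible_as_cnf :: "nat \<Rightarrow> real \<Rightarrow> 'v ext_formula \<Rightarrow> bool" where
  "expressible_as_cnf r M F \<longleftrightarrow>
     (\<exists>G. conjunctive_normal_form r G \<and> real (length G) \<le> M \<and> cnf_vars G \<subseteq> ext_vars F \<and>
          (\<forall>\<sigma>. cnf_sat \<sigma> G \<longleftrightarrow> ext_sat \<sigma> F))"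

section \<open>The construction\<close>

text \<open>
  The formula has to be constructed from the number \<open>x\<close>, without knowing its factors: for a fixed
  product \<open>x = p * q\<close> the mere existence of a formula would be witnessed by hard-wiring \<open>p\<close> and \<open>q\<close>.
  So the construction is given explicitly. It computes \<open>u * v\<close> modulo \<open>2 ^ e 0\<close> and modulo
  \<open>2 ^ e i - 1\<close> and \<open>2 ^ e i + 1\<close> for \<open>1 \<le> i \<le> k\<close> by Boolean circuits that do not depend on \<open>x\<close>, and
  compares the results with the residues of \<open>x\<close>, the only way in which \<open>x\<close> is used.
\<close>

datatype operand = U | V

datatype part =
  Fold nat operand    \<comment> \<open>operand modulo \<open>2 ^ (2 * e i) - 1\<close>\<close>
| Minus nat operand   \<comment> \<open>operand modulo \<open>2 ^ e i - 1\<close>\<close>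
| Plus nat operand    \<comment> \<open>operand modulo \<open>2 ^ e i + 1\<close>\<close>
| MulMinus nat
| MulPlus nat
| MulPow

text \<open>
  \<open>Input U j\<close> is the bit of \<open>u\<close> of weight \<open>2 ^ j\<close>. In the adder of row \<open>r\<close>, \<open>Sum _ r j\<close> is output bit
  \<open>j\<close> and \<open>Carry _ r j\<close> the carry into position \<open>j\<close>.
\<close>

datatype var =
  Input operand nat
| And part nat nat
| Sum part nat nat
| Carry part nat nat

datatype signal = Const bool | Wire var | Inv var

type_synonym word = "nat \<Rightarrow> signal"

fun signal_vars :: "signal \<Rightarrow> var set" where
  "signal_vars (Const b) = {}"
| "signal_vars (Wire y) = {y}"
| "signal_vars (Inv y) = {y}"

fun signal_val :: "var assignment \<Rightarrow> signal \<Rightarrow> bool" where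
  "signal_val \<sigma> (Const b) = b"
| "signal_val \<sigma> (Wire y) = \<sigma> y"
| "signal_val \<sigma> (Inv y) = (\<not> \<sigma> y)"

fun inv_signal :: "signal \<Rightarrow> signal" where
  "inv_signal (Const b) = Const (\<not> b)"
| "inv_signal (Wire y) = Inv y"
| "inv_signal (Inv y) = Wire y"

definition and_gate :: "var \<Rightarrow> signal \<Rightarrow> signal \<Rightarrow> var ext_clause" where
  "and_gate y a b = ({y} \<union> signal_vars a \<union> signal_vars b,
     \<lambda>\<sigma>. \<sigma> y = (signal_val \<sigma> a \<and> signal_val \<sigma> b))"

definition sum_gate :: "var \<Rightarrow> signal \<Rightarrow> signal \<Rightarrow> signal \<Rightarrow> var ext_clause" where
  "sum_gate y a b c = ({y} \<union> signal_vars a \<union> signal_vars b \<union> signal_vars c,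
     \<lambda>\<sigma>. \<sigma> y = odd (of_bool (signal_val \<sigma> a) + of_bool (signal_val \<sigma> b)
                    + of_bool (signal_val \<sigma> c) :: nat))"

definition carry_gate :: "var \<Rightarrow> signal \<Rightarrow> signal \<Rightarrow> signal \<Rightarrow> var ext_clause" where
  "carry_gate y a b c = ({y} \<union> signal_vars a \<union> signal_vars b \<union> signal_vars c,
     \<lambda>\<sigma>. \<sigma> y = (of_bool (signal_val \<sigma> a) + of_bool (signal_val \<sigma> b)
                 + of_bool (signal_val \<sigma> c) \<ge> (2 :: nat)))"

text \<open>
  Addition of \<open>A\<close> and \<open>B\<close> on the positions \<open>lo, \<dots>, n - 1\<close> with carry-in \<open>cin\<close>; the carries out of the
  positions below \<open>m\<close> are computed.
\<close>

definition adder ::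
  "part \<Rightarrow> nat \<Rightarrow> nat \<Rightarrow> nat \<Rightarrow> nat \<Rightarrow> word \<Rightarrow> word \<Rightarrow> signal \<Rightarrow> var ext_formula" where
  "adder p r lo n m A B cin =
     (let c = (\<lambda>j. if j = lo then cin else Wire (Carry p r j)) in
      map (\<lambda>j. sum_gate (Sum p r j) (A j) (B j) (c j)) [lo..<n] @
      map (\<lambda>j. carry_gate (Carry p r (Suc j)) (A j) (B j) (c j)) [lo..<m])"

definition acc :: "part \<Rightarrow> (nat \<Rightarrow> word) \<Rightarrow> nat \<Rightarrow> word" where
  "acc p row r = (if r = 0 then row 0 else (\<lambda>j. Wire (Sum p r j)))"

text \<open>
  Sum of the rows \<open>0, \<dots>, R - 1\<close> modulo \<open>2 ^ n - 1\<close>: the carry out of each adder is fed back as its own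
  carry-in, since \<open>2 ^ n\<close> is congruent to \<open>1\<close>.
\<close>

definition sum_minus :: "part \<Rightarrow> nat \<Rightarrow> (nat \<Rightarrow> word) \<Rightarrow> nat \<Rightarrow> var ext_formula" where
  "sum_minus p n row R =
     concat (map (\<lambda>r. adder p r 0 n n (acc p row (r - 1)) (row r) (Wire (Carry p r n))) [1..<R])"

text \<open>
  Sum modulo \<open>2 ^ n + 1\<close>: an intermediate result is a word \<open>s\<close> with a carry \<open>t\<close>, representing \<open>s - t\<close>
  because \<open>2 ^ n\<close> is congruent to \<open>-1\<close>. The negated carry is fed into the next adder. As
  \<open>s + b + (1 - t)\<close> is \<open>(s - t) + b + 1\<close>, each of the \<open>R - 1\<close> additions increases the result by one.
\<close>

definition carry_plus :: "part \<Rightarrow> nat \<Rightarrow> signal \<Rightarrow> nat \<Rightarrow> signal" where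
  "carry_plus p n t r = (if r = 0 then t else Wire (Carry p r n))"

definition sum_plus :: "part \<Rightarrow> nat \<Rightarrow> (nat \<Rightarrow> word) \<Rightarrow> signal \<Rightarrow> nat \<Rightarrow> var ext_formula" where
  "sum_plus p n row t R =
     concat (map (\<lambda>r. adder p r 0 n n (acc p row (r - 1)) (row r)
                        (inv_signal (carry_plus p n t (r - 1)))) [1..<R])"

subsection \<open>Reduction of the operands\<close>

definition input_word :: "nat \<Rightarrow> operand \<Rightarrow> word" where
  "input_word l z j = (if j < l then Wire (Input z j) else Const False)"

definition fold_rows :: "nat \<Rightarrow> nat \<Rightarrow> operand \<Rightarrow> nat \<Rightarrow> word" where
  "fold_rows l n z r j = input_word l z (2 * n * r + j)"

definition fold_count :: "nat \<Rightarrow> nat \<Rightarrow> nat" where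
  "fold_count l n = (l + 2 * n - 1) div (2 * n)"

definition fold_word :: "nat \<Rightarrow> nat \<Rightarrow> nat \<Rightarrow> operand \<Rightarrow> word" where
  "fold_word l i n z = acc (Fold i z) (fold_rows l n z) (fold_count l n - 1)"

definition fold_formula :: "nat \<Rightarrow> nat \<Rightarrow> nat \<Rightarrow> operand \<Rightarrow> var ext_formula" where
  "fold_formula l i n z = sum_minus (Fold i z) (2 * n) (fold_rows l n z) (fold_count l n)"

definition minus_word :: "nat \<Rightarrow> operand \<Rightarrow> word" where
  "minus_word i z j = Wire (Sum (Minus i z) 1 j)"

definition minus_formula :: "nat \<Rightarrow> nat \<Rightarrow> nat \<Rightarrow> operand \<Rightarrow> var ext_formula" where
  "minus_formula l i n z =
     sum_minus (Minus i z) n (\<lambda>r j. fold_word l i n z (r * n + j)) 2"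

text \<open>
  For a folded operand with low half \<open>a\<close> and high half \<open>b\<close>, \<open>plus_formula\<close> adds the complement of \<open>b\<close>
  to \<open>a\<close>, which gives \<open>s - t\<close> congruent to \<open>a - b - 1\<close>. So the operand is congruent to
  \<open>plus_word + plus_extra\<close>, where \<open>plus_extra\<close> is the single bit \<open>1 - t\<close>.
\<close>

definition plus_word :: "nat \<Rightarrow> operand \<Rightarrow> word" where
  "plus_word i z j = Wire (Sum (Plus i z) 1 j)"

definition plus_extra :: "nat \<Rightarrow> nat \<Rightarrow> operand \<Rightarrow> signal" where
  "plus_extra i n z = Inv (Carry (Plus i z) 1 n)"

definition plus_formula :: "nat \<Rightarrow> nat \<Rightarrow> nat \<Rightarrow> operand \<Rightarrow> var ext_formula" where
  "plus_formula l i n z =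
     sum_plus (Plus i z) n
       (\<lambda>r j. if r = 0 then fold_word l i n z j else inv_signal (fold_word l i n z (n + j)))
       (Const False) 2"

subsection \<open>Multiplication and comparison\<close>

definition compare_minus :: "nat \<Rightarrow> nat \<Rightarrow> word \<Rightarrow> var ext_formula" where
  "compare_minus n x s =
     (let X = x mod (2 ^ n - 1) in
      map (\<lambda>j. (signal_vars (s j) \<union> signal_vars (s (Suc j mod n)),
                \<lambda>\<sigma>. if X = 0 then signal_val \<sigma> (s j) = signal_val \<sigma> (s (Suc j mod n))
                     else signal_val \<sigma> (s j) = bit X j)) [0..<n])"

definition mul_minus_formula :: "nat \<Rightarrow> nat \<Rightarrow> nat \<Rightarrow> var ext_formula" where
  "mul_minus_formula i n x =
     (let p = MulMinus i; row = (\<lambda>r j. Wire (And p r j)) in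
      concat (map (\<lambda>r. map (\<lambda>j.
        and_gate (And p r j) (minus_word i U r) (minus_word i V ((j + n - r) mod n))) [0..<n]) [0..<n]) @
      sum_minus p n row n @
      compare_minus n x (acc p row (n - 1)))"

definition compare_plus :: "nat \<Rightarrow> nat \<Rightarrow> word \<Rightarrow> signal \<Rightarrow> var ext_formula" where
  "compare_plus n X s t =
     map (\<lambda>j. (signal_vars (s j) \<union> signal_vars t,
               \<lambda>\<sigma>. if signal_val \<sigma> t
                    then X \<noteq> 2 ^ n - 1 \<and> signal_val \<sigma> (s j) = bit ((X + 1) mod (2 ^ n + 1)) j
                    else X \<noteq> 2 ^ n \<and> signal_val \<sigma> (s j) = bit X j)) [0..<n]"

text \<open>
  With operands \<open>a + c\<close> and \<open>b + d\<close> for single bits \<open>c\<close> and \<open>d\<close>, the rows are the partial products of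
  \<open>a * b\<close>, with inverted bits where they wrap around, followed by \<open>d * a\<close> and \<open>c * b\<close>; the initial
  carry contributes \<open>c * d - 1\<close>. Row \<open>r < n\<close> exceeds its partial product by \<open>2 ^ r - 1\<close>, and the \<open>n + 1\<close>
  additions contribute one each, so the result is congruent to the product plus \<open>2 ^ n - 1\<close>.
\<close>

definition mul_plus_formula :: "nat \<Rightarrow> nat \<Rightarrow> nat \<Rightarrow> var ext_formula" where
  "mul_plus_formula i n x =
     (let p = MulPlus i;
          row = (\<lambda>r j. if j < r \<and> r < n then Inv (And p r j) else Wire (And p r j));
          t = Inv (And p (n + 2) 0) in
      concat (map (\<lambda>r. map (\<lambda>j.
        and_gate (And p r j) (plus_word i U r) (plus_word i V ((j + n - r) mod n))) [0..<n]) [0..<n]) @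
      map (\<lambda>j. and_gate (And p n j) (plus_extra i n V) (plus_word i U j)) [0..<n] @
      map (\<lambda>j. and_gate (And p (n + 1) j) (plus_extra i n U) (plus_word i V j)) [0..<n] @
      [and_gate (And p (n + 2) 0) (plus_extra i n U) (plus_extra i n V)] @
      sum_plus p n row t (n + 2) @
      compare_plus n ((x + 2 ^ n - 1) mod (2 ^ n + 1)) (acc p row (n + 1)) (carry_plus p n t (n + 1)))"

text \<open>
  Modulo \<open>2 ^ n\<close>, row \<open>r\<close> starts at position \<open>r\<close>; the lower positions of the sum are final.
\<close>

definition acc_pow :: "nat \<Rightarrow> word" where
  "acc_pow r j =
     (if min r j = 0 then Wire (And MulPow 0 j) else Wire (Sum MulPow (min r j) j))"

definition mul_pow_formula :: "nat \<Rightarrow> nat \<Rightarrow> nat \<Rightarrow> var ext_formula" where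
  "mul_pow_formula l n x =
     concat (map (\<lambda>r. map (\<lambda>j.
       and_gate (And MulPow r j) (input_word l U r) (input_word l V (j - r))) [r..<n]) [0..<n]) @
     concat (map (\<lambda>r.
       adder MulPow r r n (n - 1) (acc_pow (r - 1)) (\<lambda>j. Wire (And MulPow r j)) (Const False)) [1..<n]) @
     map (\<lambda>j. (signal_vars (acc_pow (n - 1) j),
               \<lambda>\<sigma>. signal_val \<sigma> (acc_pow (n - 1) j) = bit x j)) [0..<n]"

definition factoring_formula :: "nat \<Rightarrow> nat \<Rightarrow> (nat \<Rightarrow> nat) \<Rightarrow> nat \<Rightarrow> var ext_formula" where
  "factoring_formula l k e x =
     mul_pow_formula l (e 0) x @
     concat (map (\<lambda>i.
       fold_formula l i (e i) U @ fold_formula l i (e i) V @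
       minus_formula l i (e i) U @ minus_formula l i (e i) V @ mul_minus_formula i (e i) x @
       plus_formula l i (e i) U @ plus_formula l i (e i) V @ mul_plus_formula i (e i) x) [1..<Suc k])"

definition encodes :: "nat \<Rightarrow> var assignment \<Rightarrow> operand \<Rightarrow> nat \<Rightarrow> bool" where
  "encodes l \<sigma> z u \<longleftrightarrow> (\<forall>j<l. \<sigma> (Input z j) = bit u j)"

end

theory Submission
  imports Defs "HOL-Number_Theory.Cong"
begin

text \<open>
  The gates of the formula define their output variables from the input bits one after another, so
  every assignment to the inputs extends to one that satisfies all gates; only the end-around
  carries are cyclic, and there a fixed point is found by monotonicity. Under every such extension
  the output words are congruent to \<open>u * v\<close> modulo \<open>2 ^ e 0\<close>, \<open>2 ^ e i - 1\<close> and
  \<open>2 ^ e i + 1\<close>, up to a known shift, even where the extension is not unique. Hence the comparison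
  clauses hold iff \<open>u * v\<close> and \<open>x\<close> agree modulo the least common multiple, which exceeds both.
\<close>

section \<open>Concatenation of formulas\<close>

text \<open>Modulo \<open>2 ^ n - 1\<close> doubling rotates an \<open>n\<close>-bit word; modulo
  \<open>2 ^ n + 1\<close> the bit that wraps around also changes sign. So shifts are mere wiring
  and only additions cost gates. The price is redundancy. Zero has two codes modulo
  \<open>2 ^ n - 1\<close>, all zeros and all ones, and an end-around adder with complementary
  operands admits both: carry 0 gives all ones, carry 1 all zeros. Modulo \<open>2 ^ n + 1\<close>
  there is one residue more than there are words, so a word comes with a subtracted bit. Hence
  outputs are not functions of the inputs; only their residue classes are, and each comparison must
  accept every code of its residue. Each gate is one clause defining one variable, so a single count
  bounds both. Folding an operand takes fewer than \<open>l\<close> adder positions with two gates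
  each, which for two operands is the origin of \<open>4 * k * l\<close>. Each of the two
  multipliers for an index has about \<open>n ^ 2\<close> bit products and as many adder positions,
  whence \<open>6 * n ^ 2\<close>; for \<open>2 ^ e 0\<close> only a triangle of both is needed,
  whence \<open>3 / 2\<close>.\<close>

lemma ext_sat_append: "ext_sat \<sigma> (F @ G) \<longleftrightarrow> ext_sat \<sigma> F \<and> ext_sat \<sigma> G"
  by (auto simp: ext_sat_def)

lemma ext_sat_concat: "ext_sat \<sigma> (concat Fs) \<longleftrightarrow> (\<forall>F\<in>set Fs. ext_sat \<sigma> F)"
  by (auto simp: ext_sat_def)

lemma ext_vars_append: "ext_vars (F @ G) = ext_vars F \<union> ext_vars G"
  by (auto simp: ext_vars_def)

lemma ext_vars_concat: "ext_vars (concat Fs) = (\<Union>F\<in>set Fs. ext_vars F)"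
  by (auto simp: ext_vars_def)

lemma ext_conjunctive_form_append:
  "ext_conjunctive_form r (F @ G) \<longleftrightarrow> ext_conjunctive_form r F \<and> ext_conjunctive_form r G"
  by (auto simp: ext_conjunctive_form_def)

lemma ext_conjunctive_form_concat:
  "ext_conjunctive_form r (concat Fs) \<longleftrightarrow> (\<forall>F\<in>set Fs. ext_conjunctive_form r F)"
  by (auto simp: ext_conjunctive_form_def)

text \<open>This is where \<open>on_vars\<close> enters. It allows later circuits to be solved
  without disturbing clauses that are already satisfied.\<close>

lemma ext_sat_cong:
  assumes "ext_conjunctive_form r F" "\<And>y. y \<in> ext_vars F \<Longrightarrow> \<sigma> y = \<tau> y"
  shows "ext_sat \<sigma> F \<longleftrightarrow> ext_sat \<tau> F"
proof -
  have "snd C \<sigma> = snd C \<tau>" if "C \<in> set F" for C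
  proof -
    have "on_vars (fst C) (snd C)" using assms(1) that by (auto simp: ext_conjunctive_form_def)
    moreover have "\<forall>y\<in>fst C. \<sigma> y = \<tau> y" using assms(2) that by (force simp: ext_vars_def)
    ultimately show ?thesis unfolding on_vars_def by blast
  qed
  then show ?thesis by (simp add: ext_sat_def case_prod_beta)
qed

section \<open>Conversion to conjunctive normal form\<close>

lemma expressible_as_cnf_append:
  assumes "expressible_as_cnf r M F" "expressible_as_cnf r N G"
  shows "expressible_as_cnf r (M + N) (F @ G)"
proof -
  obtain A B where
    "conjunctive_normal_form r A" "real (length A) \<le> M" "cnf_vars A \<subseteq> ext_vars F"
    "\<forall>\<sigma>. cnf_sat \<sigma> A \<longleftrightarrow> ext_sat \<sigma> F"
    "conjunctive_normal_form r B" "real (length B) \<le> N" "cnf_vars B \<subseteq> ext_vars G"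
    "\<forall>\<sigma>. cnf_sat \<sigma> B \<longleftrightarrow> ext_sat \<sigma> G"
    using assms by (auto simp: expressible_as_cnf_def)
  moreover have "cnf_sat \<sigma> (A @ B) \<longleftrightarrow> cnf_sat \<sigma> A \<and> cnf_sat \<sigma> B" for \<sigma>
    by (auto simp: cnf_sat_def)
  moreover have "cnf_vars (A @ B) = cnf_vars A \<union> cnf_vars B"
    by (auto simp: cnf_vars_def)
  moreover have "conjunctive_normal_form r (A @ B) \<longleftrightarrow>
      conjunctive_normal_form r A \<and> conjunctive_normal_form r B"
    by (auto simp: conjunctive_normal_form_def)
  ultimately show ?thesis unfolding expressible_as_cnf_def ext_vars_append
    by (intro exI[of _ "A @ B"]) (simp add: ext_sat_append le_supI1 le_supI2)
qed

lemma expressible_as_cnf_Nil: "expressible_as_cnf r 0 []"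
  unfolding expressible_as_cnf_def
  by (intro exI[of _ "[]"]) (auto simp: conjunctive_normal_form_def cnf_vars_def cnf_sat_def ext_sat_def)

lemma expressible_as_cnf_mono:
  "expressible_as_cnf r M F \<Longrightarrow> M \<le> N \<Longrightarrow> expressible_as_cnf r N F"
  unfolding expressible_as_cnf_def by (meson order_trans)

lemma expressible_as_cnf_concat:
  assumes "\<And>a. a \<in> set xs \<Longrightarrow> expressible_as_cnf r (c a) (f a)"
  shows "expressible_as_cnf r (sum_list (map c xs)) (concat (map f xs))"
  using assms
  by (induction xs) (auto intro: expressible_as_cnf_append expressible_as_cnf_Nil)

lemma expressible_as_cnf_concat_const:
  assumes "\<And>a. a \<in> set xs \<Longrightarrow> expressible_as_cnf r c (f a)"
  shows "expressible_as_cnf r (real (length xs) * c) (concat (map f xs))"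
  using expressible_as_cnf_concat[of xs r "\<lambda>_. c" f] assms by (simp add: sum_list_triv)

lemma expressible_as_cnf_map:
  assumes "\<And>a. a \<in> set xs \<Longrightarrow> expressible_as_cnf r c [f a]"
  shows "expressible_as_cnf r (real (length xs) * c) (map f xs)"
  using expressible_as_cnf_concat_const[of xs r c "\<lambda>a. [f a]"] assms by simp

section \<open>Signals and clauses over signals\<close>

lemma inv_signal_vars [simp]: "signal_vars (inv_signal s) = signal_vars s"
  by (cases s) auto

lemma inv_signal_val [simp]: "signal_val \<sigma> (inv_signal s) = (\<not> signal_val \<sigma> s)"
  by (cases s) auto

lemma signal_val_cong:
  "(\<And>y. y \<in> signal_vars s \<Longrightarrow> \<sigma> y = \<tau> y) \<Longrightarrow> signal_val \<sigma> s = signal_val \<tau> s"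
  by (cases s) auto

lemma finite_signal_vars [simp]: "finite (signal_vars s)"
  by (cases s) auto

lemma card_signal_vars: "card (signal_vars s) \<le> 1"
  by (cases s) auto

fun signal_literals :: "signal \<Rightarrow> var literal list" where
  "signal_literals (Const b) = []"
| "signal_literals (Wire y) = [Pos y]"
| "signal_literals (Inv y) = [Neg y]"

text \<open>\<open>signal_literals\<close> sends both constants to the empty list. That is right for
  \<open>Const False\<close>; a clause with \<open>Const True\<close> holds under every assignment
  and has to be removed beforehand by the filter.\<close>

definition signal_cnf :: "signal list list \<Rightarrow> var cnf" where
  "signal_cnf Cs = map (\<lambda>C. concat (map signal_literals C)) (filter (\<lambda>C. Const True \<notin> set C) Cs)"

lemma signal_literals_sat:
  "s \<noteq> Const True \<Longrightarrow> (\<exists>a\<in>set (signal_literals s). literal_sat \<sigma> a) \<longleftrightarrow> signal_val \<sigma> s"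
  by (cases s) auto

lemma signal_literals_vars: "literal_var ` set (signal_literals s) \<subseteq> signal_vars s"
  by (cases s) auto

lemma length_signal_literals: "length (concat (map signal_literals C)) \<le> length C"
proof (induction C)
  case (Cons s C)
  then show ?case by (cases s) auto
qed simp

lemma signal_cnf_sat:
  "cnf_sat \<sigma> (signal_cnf Cs) \<longleftrightarrow> (\<forall>C\<in>set Cs. \<exists>s\<in>set C. signal_val \<sigma> s)"
proof -
  have *: "(Const True \<notin> set C \<longrightarrow> (\<exists>a\<in>set (concat (map signal_literals C)). literal_sat \<sigma> a))
      \<longleftrightarrow> (\<exists>s\<in>set C. signal_val \<sigma> s)" for C
  proof (cases "Const True \<in> set C")
    case True
    then show ?thesis by (metis signal_val.simps(1))
  next
    case False
    have "(\<exists>a\<in>set (concat (map signal_literals C)). literal_sat \<sigma> a) \<longleftrightarrow>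
        (\<exists>s\<in>set C. \<exists>a\<in>set (signal_literals s). literal_sat \<sigma> a)"
      by simp
    also have "\<dots> \<longleftrightarrow> (\<exists>s\<in>set C. signal_val \<sigma> s)"
      using False by (intro bex_cong refl signal_literals_sat) metis
    finally show ?thesis using False by simp
  qed
  have "cnf_sat \<sigma> (signal_cnf Cs) \<longleftrightarrow> (\<forall>C\<in>set Cs. Const True \<notin> set C \<longrightarrow>
      (\<exists>a\<in>set (concat (map signal_literals C)). literal_sat \<sigma> a))"
    unfolding cnf_sat_def signal_cnf_def set_map set_filter by blast
  then show ?thesis by (simp only: *)
qed

lemma signal_cnf_vars: "cnf_vars (signal_cnf Cs) \<subseteq> (\<Union>C\<in>set Cs. \<Union>s\<in>set C. signal_vars s)"
proof -
  have "cnf_vars (signal_cnf Cs) \<subseteq> (\<Union>C\<in>set Cs. \<Union>s\<in>set C. literal_var ` set (signal_literals s))"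
    by (auto simp: cnf_vars_def signal_cnf_def)
  also have "\<dots> \<subseteq> (\<Union>C\<in>set Cs. \<Union>s\<in>set C. signal_vars s)"
    by (intro UN_mono signal_literals_vars order_refl)
  finally show ?thesis .
qed

text \<open>
  Clauses are written over signals; constants are eliminated by \<^const>\<open>signal_cnf\<close>, which never
  increases the number or the length of clauses.
\<close>

lemma expressible_as_cnf_signals:
  assumes "\<And>\<sigma>. P \<sigma> \<longleftrightarrow> (\<forall>C\<in>set Cs. \<exists>s\<in>set C. signal_val \<sigma> s)"
    and "(\<Union>C\<in>set Cs. \<Union>s\<in>set C. signal_vars s) \<subseteq> S"
    and "\<forall>C\<in>set Cs. length C \<le> r"
  shows "expressible_as_cnf r (real (length Cs)) [(S, P)]"
proof -
  have "conjunctive_normal_form r (signal_cnf Cs)"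
    using assms(3) length_signal_literals order_trans
    unfolding conjunctive_normal_form_def signal_cnf_def by fastforce
  moreover have "length (signal_cnf Cs) \<le> length Cs"
    by (simp add: signal_cnf_def)
  moreover have "cnf_vars (signal_cnf Cs) \<subseteq> ext_vars [(S, P)]"
    using signal_cnf_vars[of Cs] assms(2) by (auto simp: ext_vars_def)
  ultimately show ?thesis unfolding expressible_as_cnf_def
    using assms(1) by (intro exI[of _ "signal_cnf Cs"]) (simp add: signal_cnf_sat ext_sat_def)
qed

section \<open>Clauses per gate, adder and comparison\<close>

lemma and_gate_cnf: "expressible_as_cnf 4 3 [and_gate y a b]"
proof -
  let ?Cs = "[[Inv y, a], [Inv y, b], [Wire y, inv_signal a, inv_signal b]]"
  have "expressible_as_cnf 4 (real (length ?Cs)) [and_gate y a b]"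
    unfolding and_gate_def by (rule expressible_as_cnf_signals) auto
  then show ?thesis by simp
qed

text \<open>The gate is a parity constraint on four bits; each clause excludes one of the eight
  assignments of wrong parity.\<close>

lemma sum_gate_cnf: "expressible_as_cnf 4 8 [sum_gate y a b c]"
proof -
  let ?a = "inv_signal a" and ?b = "inv_signal b" and ?c = "inv_signal c"
  let ?Cs = "[[Inv y, a, b, c], [Inv y, a, ?b, ?c], [Inv y, ?a, b, ?c], [Inv y, ?a, ?b, c],
    [Wire y, ?a, b, c], [Wire y, a, ?b, c], [Wire y, a, b, ?c], [Wire y, ?a, ?b, ?c]]"
  have "expressible_as_cnf 4 (real (length ?Cs)) [sum_gate y a b c]"
    unfolding sum_gate_def
  proof (rule expressible_as_cnf_signals)
    show "\<sigma> y = odd (of_bool (signal_val \<sigma> a) + of_bool (signal_val \<sigma> b)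
        + of_bool (signal_val \<sigma> c) :: nat) \<longleftrightarrow>
      (\<forall>C\<in>set ?Cs. \<exists>s\<in>set C. signal_val \<sigma> s)" for \<sigma>
      by (cases "signal_val \<sigma> a"; cases "signal_val \<sigma> b"; cases "signal_val \<sigma> c"; cases "\<sigma> y") simp_all
  qed auto
  then show ?thesis by simp
qed

text \<open>A majority is true iff every pair of inputs contains a true one, and false iff every
  pair contains a false one: three pairs for each direction.\<close>

lemma carry_gate_cnf: "expressible_as_cnf 4 6 [carry_gate y a b c]"
proof -
  let ?a = "inv_signal a" and ?b = "inv_signal b" and ?c = "inv_signal c"
  let ?Cs = "[[Inv y, a, b], [Inv y, a, c], [Inv y, b, c],
    [Wire y, ?a, ?b], [Wire y, ?a, ?c], [Wire y, ?b, ?c]]"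
  have "expressible_as_cnf 4 (real (length ?Cs)) [carry_gate y a b c]"
    unfolding carry_gate_def
  proof (rule expressible_as_cnf_signals)
    show "\<sigma> y = (of_bool (signal_val \<sigma> a) + of_bool (signal_val \<sigma> b)
        + of_bool (signal_val \<sigma> c) \<ge> (2 :: nat)) \<longleftrightarrow>
      (\<forall>C\<in>set ?Cs. \<exists>s\<in>set C. signal_val \<sigma> s)" for \<sigma>
      by (cases "signal_val \<sigma> a"; cases "signal_val \<sigma> b"; cases "signal_val \<sigma> c"; cases "\<sigma> y") simp_all
  qed auto
  then show ?thesis by simp
qed

lemma adder_cnf: "expressible_as_cnf 4 (8 * real (n - lo) + 6 * real (m - lo)) (adder p r lo n m A B cin)"
proof -
  have "expressible_as_cnf 4 (real (length [lo..<n]) * 8 + real (length [lo..<m]) * 6)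
     (adder p r lo n m A B cin)"
    unfolding adder_def Let_def
    by (intro expressible_as_cnf_append expressible_as_cnf_map sum_gate_cnf carry_gate_cnf)
  then show ?thesis by (simp add: mult.commute)
qed

text \<open>14 is 8 clauses for the sum bit plus 6 for the carry at each position.\<close>

lemma sum_minus_cnf: "expressible_as_cnf 4 (14 * real n * real (R - 1)) (sum_minus p n row R)"
proof -
  have "expressible_as_cnf 4 (real (length [1..<R]) * (8 * real (n - 0) + 6 * real (n - 0)))
     (sum_minus p n row R)"
    unfolding sum_minus_def by (intro expressible_as_cnf_concat_const adder_cnf)
  then show ?thesis by (simp add: algebra_simps)
qed

lemma sum_plus_cnf: "expressible_as_cnf 4 (14 * real n * real (R - 1)) (sum_plus p n row t R)"
proof -
  have "expressible_as_cnf 4 (real (length [1..<R]) * (8 * real (n - 0) + 6 * real (n - 0)))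
     (sum_plus p n row t R)"
    unfolding sum_plus_def by (intro expressible_as_cnf_concat_const adder_cnf)
  then show ?thesis by (simp add: algebra_simps)
qed

lemma compare_minus_cnf: "expressible_as_cnf 4 (2 * real n) (compare_minus n x s)"
proof -
  define X where "X = x mod (2 ^ n - 1)"
  have "expressible_as_cnf 4 2 [(signal_vars (s j) \<union> signal_vars (s (Suc j mod n)),
      \<lambda>\<sigma>. if X = 0 then signal_val \<sigma> (s j) = signal_val \<sigma> (s (Suc j mod n))
          else signal_val \<sigma> (s j) = bit X j)]" for j
  proof -
    let ?t = "s (Suc j mod n)"
    \<comment> \<open>An equivalence of neighbouring bits takes two clauses, a prescribed bit only a
      unit clause.\<close>
    let ?Cs = "if X = 0 then [[inv_signal (s j), ?t], [s j, inv_signal ?t]]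
      else [[if bit X j then s j else inv_signal (s j)]]"
    have "expressible_as_cnf 4 (real (length ?Cs)) [(signal_vars (s j) \<union> signal_vars ?t,
      \<lambda>\<sigma>. if X = 0 then signal_val \<sigma> (s j) = signal_val \<sigma> ?t
          else signal_val \<sigma> (s j) = bit X j)]"
      by (rule expressible_as_cnf_signals) (auto split: if_splits)
    then show ?thesis by (rule expressible_as_cnf_mono) auto
  qed
  then have "expressible_as_cnf 4 (real (length [0..<n]) * 2) (compare_minus n x s)"
    unfolding compare_minus_def Let_def X_def by (intro expressible_as_cnf_map)
  then show ?thesis by (simp add: mult.commute)
qed

lemma compare_plus_cnf: "expressible_as_cnf 4 (2 * real n) (compare_plus n X s t)"
proof -
  let ?Y = "(X + 1) mod (2 ^ n + 1)"
  have "expressible_as_cnf 4 2 [(signal_vars (s j) \<union> signal_vars t,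
      \<lambda>\<sigma>. if signal_val \<sigma> t then X \<noteq> 2 ^ n - 1 \<and> signal_val \<sigma> (s j) = bit ?Y j
          else X \<noteq> 2 ^ n \<and> signal_val \<sigma> (s j) = bit X j)]" for j
  proof -
    \<comment> \<open>One clause for each value of \<open>t\<close>. If no word is right for that
      value, the clause shrinks to a unit clause excluding it.\<close>
    let ?Cs = "[inv_signal t # (if X = 2 ^ n - 1 then [] else [if bit ?Y j then s j else inv_signal (s j)]),
      t # (if X = 2 ^ n then [] else [if bit X j then s j else inv_signal (s j)])]"
    have "expressible_as_cnf 4 (real (length ?Cs)) [(signal_vars (s j) \<union> signal_vars t,
      \<lambda>\<sigma>. if signal_val \<sigma> t then X \<noteq> 2 ^ n - 1 \<and> signal_val \<sigma> (s j) = bit ?Y j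
          else X \<noteq> 2 ^ n \<and> signal_val \<sigma> (s j) = bit X j)]"
      by (rule expressible_as_cnf_signals) (auto split: if_splits)
    then show ?thesis by (rule expressible_as_cnf_mono) auto
  qed
  then have "expressible_as_cnf 4 (real (length [0..<n]) * 2) (compare_plus n X s t)"
    unfolding compare_plus_def by (intro expressible_as_cnf_map)
  then show ?thesis by (simp add: mult.commute)
qed

section \<open>Circuits\<close>

text \<open>
  \<open>I\<close> are the input variables and \<open>D\<close> the variables computed by \<open>F\<close>; they need not be determined
  by the inputs, as the adders with end-around carry may have two solutions.
\<close>

definition circuit :: "var set \<Rightarrow> var set \<Rightarrow> var ext_formula \<Rightarrow> bool" where
  "circuit I D F \<longleftrightarrow> ext_conjunctive_form 4 F \<and> ext_vars F \<subseteq> I \<union> D \<and> I \<inter> D = {} \<and>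
     finite D \<and> card D \<le> length F \<and> (\<forall>\<sigma>. \<exists>\<tau>. (\<forall>y. y \<notin> D \<longrightarrow> \<tau> y = \<sigma> y) \<and> ext_sat \<tau> F)"

lemma circuitD:
  assumes "circuit I D F"
  shows "ext_conjunctive_form 4 F" "ext_vars F \<subseteq> I \<union> D" "I \<inter> D = {}" "finite D" "card D \<le> length F"
  using assms by (simp_all add: circuit_def)

lemma circuit_solution:
  assumes "circuit I D F"
  obtains \<tau> where "\<forall>y. y \<notin> D \<longrightarrow> \<tau> y = \<sigma> y" "ext_sat \<tau> F"
proof -
  have "\<exists>\<tau>. (\<forall>y. y \<notin> D \<longrightarrow> \<tau> y = \<sigma> y) \<and> ext_sat \<tau> F"
    using assms unfolding circuit_def by (elim conjE allE)
  then show thesis by (elim exE conjE) (rule that)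
qed

text \<open>Solve \<open>F\<close> first and then \<open>G\<close> on top of it: the second step
  changes variables of \<open>E\<close> only, and none of these occurs in \<open>F\<close>.\<close>

lemma circuit_append:
  assumes F: "circuit I D F" and G: "circuit J E G" and "J \<subseteq> I \<union> D" "(I \<union> D) \<inter> E = {}"
  shows "circuit I (D \<union> E) (F @ G)"
proof -
  have "\<exists>\<tau>. (\<forall>y. y \<notin> D \<union> E \<longrightarrow> \<tau> y = \<sigma> y) \<and> ext_sat \<tau> (F @ G)" for \<sigma>
  proof -
    obtain \<rho> where \<rho>: "\<forall>y. y \<notin> D \<longrightarrow> \<rho> y = \<sigma> y" "ext_sat \<rho> F"
      by (rule circuit_solution[OF F])
    obtain \<tau> where \<tau>: "\<forall>y. y \<notin> E \<longrightarrow> \<tau> y = \<rho> y" "ext_sat \<tau> G"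
      by (rule circuit_solution[OF G])
    have "\<tau> y = \<rho> y" if "y \<in> ext_vars F" for y
      using that circuitD(2)[OF F] assms(4) \<tau>(1) by blast
    then have "ext_sat \<tau> F \<longleftrightarrow> ext_sat \<rho> F"
      by (rule ext_sat_cong[OF circuitD(1)[OF F]])
    then show ?thesis using \<rho> \<tau> by (intro exI[of _ \<tau>]) (simp add: ext_sat_append)
  qed
  moreover have "card (D \<union> E) \<le> length (F @ G)"
    using circuitD(5)[OF F] circuitD(5)[OF G] card_Un_le[of D E] by simp
  moreover have "ext_vars (F @ G) \<subseteq> I \<union> (D \<union> E)" "I \<inter> (D \<union> E) = {}"
    using circuitD(2,3)[OF F] circuitD(2)[OF G] assms(3,4) by (auto simp: ext_vars_append)
  ultimately show ?thesis
    using circuitD(1,4)[OF F] circuitD(1,4)[OF G]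
    by (simp add: circuit_def ext_conjunctive_form_append)
qed

lemma circuit_weaken:
  assumes F: "circuit I D F" and "I \<subseteq> J" "J \<inter> D = {}"
  shows "circuit J D F"
proof -
  have "ext_vars F \<subseteq> J \<union> D" using circuitD(2)[OF F] assms(2) by blast
  then show ?thesis using F assms(3) by (simp add: circuit_def)
qed

lemma circuit_Nil: "circuit I {} []"
  by (auto simp: circuit_def ext_conjunctive_form_def ext_vars_def ext_sat_def)

text \<open>Each block may read the inputs and the outputs of earlier blocks, so the order of the
  list is an order of evaluation.\<close>

lemma circuit_concat:
  assumes "\<And>r. a \<le> r \<Longrightarrow> r < b \<Longrightarrow> circuit (I \<union> (\<Union>s\<in>{a..<r}. D s)) (D r) (f r)"
  shows "circuit I (\<Union>r\<in>{a..<b}. D r) (concat (map f [a..<b]))"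
  using assms
proof (induction b)
  case 0
  then show ?case by (simp add: circuit_Nil)
next
  case (Suc b)
  show ?case
  proof (cases "a \<le> b")
    case True
    have D: "circuit (I \<union> (\<Union>s\<in>{a..<b}. D s)) (D b) (f b)" using Suc.prems True by simp
    have "circuit I ((\<Union>r\<in>{a..<b}. D r) \<union> D b) (concat (map f [a..<b]) @ f b)"
      using Suc D by (intro circuit_append[OF _ D]) (auto simp: circuit_def)
    moreover have "(\<Union>r\<in>{a..<Suc b}. D r) = (\<Union>r\<in>{a..<b}. D r) \<union> D b"
      using True by (auto simp: less_Suc_eq)
    ultimately show ?thesis using True by simp
  next
    case False
    then show ?thesis by (simp add: circuit_Nil)
  qed
qed

section \<open>Gates with up to three inputs\<close>

lemma card_gate_vars: "card ({y} \<union> signal_vars a \<union> signal_vars b \<union> signal_vars c) \<le> 4"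
proof -
  have "card ({y} \<union> signal_vars a \<union> signal_vars b \<union> signal_vars c)
      \<le> card {y} + card (signal_vars a) + card (signal_vars b) + card (signal_vars c)"
    by (meson add_right_mono card_Un_le order_trans)
  then show ?thesis using card_signal_vars[of a] card_signal_vars[of b] card_signal_vars[of c] by simp
qed

lemma on_vars_gate:
  "on_vars ({y} \<union> signal_vars a \<union> signal_vars b \<union> signal_vars c)
    (\<lambda>\<sigma>. \<sigma> y = h (signal_val \<sigma> a) (signal_val \<sigma> b) (signal_val \<sigma> c))"
  unfolding on_vars_def
proof (intro allI impI)
  fix \<sigma> \<tau> :: "var assignment"
  assume *: "\<forall>y\<in>{y} \<union> signal_vars a \<union> signal_vars b \<union> signal_vars c. \<sigma> y = \<tau> y"
  then have "signal_val \<sigma> a = signal_val \<tau> a" "signal_val \<sigma> b = signal_val \<tau> b"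
    "signal_val \<sigma> c = signal_val \<tau> c" by (intro signal_val_cong; simp)+
  with * show "(\<sigma> y = h (signal_val \<sigma> a) (signal_val \<sigma> b) (signal_val \<sigma> c)) =
    (\<tau> y = h (signal_val \<tau> a) (signal_val \<tau> b) (signal_val \<tau> c))" by simp
qed

lemma circuit_ands:
  assumes "distinct xs" "\<And>j. j \<in> set xs \<Longrightarrow> signal_vars (a j) \<union> signal_vars (b j) \<subseteq> I"
    and "I \<inter> And p r ` set xs = {}"
  shows "circuit I (And p r ` set xs) (map (\<lambda>j. and_gate (And p r j) (a j) (b j)) xs)"
    (is "circuit _ ?D ?F")
proof -
  have "ext_conjunctive_form 4 ?F"
  proof -
    have "card ({y} \<union> signal_vars s \<union> signal_vars t) \<le> 4"
      "on_vars ({y} \<union> signal_vars s \<union> signal_vars t) (\<lambda>\<sigma>. \<sigma> y = (signal_val \<sigma> s \<and> signal_val \<sigma> t))" for y s t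
      \<comment> \<open>The AND gate is treated as a three-input gate whose third input is a
        constant and adds no variable.\<close>
      using card_gate_vars[of y s t "Const True"] on_vars_gate[of y s t "Const True" "\<lambda>a b c. a \<and> b"]
      by simp_all
    then show ?thesis
      unfolding ext_conjunctive_form_def and_gate_def set_map ball_simps prod.case by simp
  qed
  moreover have "\<exists>\<tau>. (\<forall>y. y \<notin> ?D \<longrightarrow> \<tau> y = \<sigma> y) \<and> ext_sat \<tau> ?F" for \<sigma>
  proof -
    define \<tau> where "\<tau> y = (case y of And q s j \<Rightarrow>
      if q = p \<and> s = r \<and> j \<in> set xs then signal_val \<sigma> (a j) \<and> signal_val \<sigma> (b j) else \<sigma> y | _ \<Rightarrow> \<sigma> y)" for y
    have *: "\<tau> y = \<sigma> y" if "y \<notin> ?D" for y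
      using that by (cases y) (auto simp: \<tau>_def)
    have eq: "signal_val \<tau> (a j) = signal_val \<sigma> (a j)" "signal_val \<tau> (b j) = signal_val \<sigma> (b j)"
      if "j \<in> set xs" for j
      using assms(2)[OF that] assms(3) by (intro signal_val_cong *; blast)+
    have "\<tau> (And p r j) = (signal_val \<tau> (a j) \<and> signal_val \<tau> (b j))" if "j \<in> set xs" for j
      using that by (simp add: eq) (simp add: \<tau>_def)
    then have "ext_sat \<tau> ?F"
      by (simp add: ext_sat_def and_gate_def)
    with * show ?thesis by blast
  qed
  moreover have "card ?D \<le> length ?F"
    using card_image_le[of "set xs" "And p r"] card_length[of xs] by simp
  moreover have "ext_vars ?F \<subseteq> I \<union> ?D"
  proof -
    have "ext_vars ?F = (\<Union>j\<in>set xs. {And p r j} \<union> (signal_vars (a j) \<union> signal_vars (b j)))"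
      by (simp add: ext_vars_def and_gate_def)
    also have "\<dots> \<subseteq> I \<union> ?D"
      using assms(2) by (intro UN_least Un_least) auto
    finally show ?thesis .
  qed
  ultimately show ?thesis using assms(3) by (simp add: circuit_def)
qed

section \<open>Solving the clauses of an adder\<close>

definition adder_cells :: "part \<Rightarrow> nat \<Rightarrow> nat \<Rightarrow> nat \<Rightarrow> nat \<Rightarrow> var set" where
  "adder_cells p r lo n m = Sum p r ` {lo..<n} \<union> Carry p r ` {Suc lo..m}"

definition majority :: "bool \<Rightarrow> bool \<Rightarrow> bool \<Rightarrow> bool" where
  "majority a b c \<longleftrightarrow> of_bool a + of_bool b + of_bool c \<ge> (2 :: nat)"

lemma majority_simp: "majority a b c \<longleftrightarrow> (a \<and> b \<or> a \<and> c \<or> b \<and> c)"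
  by (auto simp: majority_def)

text \<open>The carry chain as a function of the value of the carry-in, detached from the
  \<open>Carry\<close> variables, so that this value can be chosen before any assignment is fixed.
  All positions up to \<open>lo\<close> hold the carry-in itself.\<close>

fun ripple :: "(nat \<Rightarrow> bool) \<Rightarrow> (nat \<Rightarrow> bool) \<Rightarrow> nat \<Rightarrow> bool \<Rightarrow> nat \<Rightarrow> bool" where
  "ripple a b lo c 0 = c"
| "ripple a b lo c (Suc j) = (if j < lo then c else majority (a j) (b j) (ripple a b lo c j))"

lemma ripple_start [simp]: "j \<le> lo \<Longrightarrow> ripple a b lo c j = c"
  by (cases j) auto

lemma ripple_mono: "ripple a b lo False j \<Longrightarrow> ripple a b lo True j"
  by (induction j) (auto simp: majority_simp split: if_splits)

lemma ext_conjunctive_form_adder: "ext_conjunctive_form 4 (adder p r lo n m A B cin)"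
proof -
  have gates: "case sum_gate y a b c of (S, P) \<Rightarrow> finite S \<and> card S \<le> 4 \<and> on_vars S P"
    "case carry_gate y a b c of (S, P) \<Rightarrow> finite S \<and> card S \<le> 4 \<and> on_vars S P" for y a b c
    unfolding sum_gate_def carry_gate_def prod.case
    by (intro conjI card_gate_vars on_vars_gate[where h = "\<lambda>a b c. odd (of_bool a + of_bool b + of_bool c :: nat)"]
      on_vars_gate[where h = "\<lambda>a b c. of_bool a + of_bool b + of_bool c \<ge> (2 :: nat)"]; simp)+
  show ?thesis
    unfolding ext_conjunctive_form_def adder_def Let_def set_append set_map ball_Un ball_simps
    by (intro conjI ballI gates)
qed

text \<open>The carry-in is guessed as a value \<open>c\<close>, and the gates hold once the
  resulting assignment gives \<open>cin\<close> that value. In this conditional form the lemma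
  serves both ordinary adders, whose \<open>cin\<close> is an earlier signal, and end-around adders,
  whose \<open>cin\<close> is their own carry out. The bounds on \<open>m\<close> allow for adders
  with all carries and for those that drop the carry out of the top position.\<close>

lemma adder_solution:
  fixes \<sigma> :: "var assignment" and c :: bool
  assumes "\<And>j. lo \<le> j \<Longrightarrow> j < n \<Longrightarrow> (signal_vars (A j) \<union> signal_vars (B j)) \<inter> adder_cells p r lo n m = {}"
    and "n - 1 \<le> m" "m \<le> n"
  obtains \<tau> where "\<And>y. y \<notin> adder_cells p r lo n m \<Longrightarrow> \<tau> y = \<sigma> y"
    and "\<And>j. lo < j \<Longrightarrow> j \<le> m \<Longrightarrow> \<tau> (Carry p r j) =
      ripple (\<lambda>j. signal_val \<sigma> (A j)) (\<lambda>j. signal_val \<sigma> (B j)) lo c j"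
    and "signal_val \<tau> cin = c \<Longrightarrow> ext_sat \<tau> (adder p r lo n m A B cin)"
proof -
  define a where "a j = signal_val \<sigma> (A j)" for j
  define b where "b j = signal_val \<sigma> (B j)" for j
  define \<tau> where "\<tau> y = (if y \<notin> adder_cells p r lo n m then \<sigma> y else case y of
      Sum _ _ j \<Rightarrow> odd (of_bool (a j) + of_bool (b j) + of_bool (ripple a b lo c j) :: nat)
    | Carry _ _ j \<Rightarrow> ripple a b lo c j | _ \<Rightarrow> \<sigma> y)" for y
  have eq: "\<tau> y = \<sigma> y" if "y \<notin> adder_cells p r lo n m" for y
    using that by (simp add: \<tau>_def)
  have carry: "\<tau> (Carry p r j) = ripple a b lo c j" if "lo < j" "j \<le> m" for j
    using that by (auto simp: \<tau>_def adder_cells_def)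
  have sm: "\<tau> (Sum p r j) = odd (of_bool (a j) + of_bool (b j) + of_bool (ripple a b lo c j) :: nat)"
    if "lo \<le> j" "j < n" for j
    using that by (auto simp: \<tau>_def adder_cells_def)
  have ab: "signal_val \<tau> (A j) = a j" "signal_val \<tau> (B j) = b j" if "lo \<le> j" "j < n" for j
    using assms(1)[OF that] unfolding a_def b_def by (intro signal_val_cong eq; blast)+
  have "ext_sat \<tau> (adder p r lo n m A B cin)" if c: "signal_val \<tau> cin = c"
  proof -
    have cj: "signal_val \<tau> (if j = lo then cin else Wire (Carry p r j)) = ripple a b lo c j"
      if "lo \<le> j" "j < n" for j
      using that c carry[of j] assms(2) by auto
    show ?thesis
      unfolding ext_sat_def adder_def Let_def set_append set_map ball_Un ball_simps
        sum_gate_def carry_gate_def prod.case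
    proof (intro conjI ballI)
      fix j assume "j \<in> set [lo..<n]"
      then have j: "lo \<le> j" "j < n" by auto
      show "\<tau> (Sum p r j) = odd (of_bool (signal_val \<tau> (A j)) + of_bool (signal_val \<tau> (B j))
          + of_bool (signal_val \<tau> (if j = lo then cin else Wire (Carry p r j))) :: nat)"
        by (simp only: ab[OF j] cj[OF j] sm[OF j])
    next
      fix j assume "j \<in> set [lo..<m]"
      then have j: "lo \<le> j" "j < n" "lo < Suc j" "Suc j \<le> m" using assms(3) by auto
      show "\<tau> (Carry p r (Suc j)) = (of_bool (signal_val \<tau> (A j)) + of_bool (signal_val \<tau> (B j))
          + of_bool (signal_val \<tau> (if j = lo then cin else Wire (Carry p r j))) \<ge> (2 :: nat))"
        using j(1) by (simp add: ab[OF j(1,2)] cj[OF j(1,2)] carry[OF j(3,4)] majority_def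
          del: signal_val.simps)
    qed
  qed
  then show thesis using eq carry unfolding a_def b_def by (intro that[of \<tau>]) assumption+
qed

lemma ext_vars_adder:
  assumes "\<And>j. lo \<le> j \<Longrightarrow> j < n \<Longrightarrow> signal_vars (A j) \<union> signal_vars (B j) \<subseteq> I"
    and "signal_vars cin \<subseteq> I \<union> adder_cells p r lo n m" "n - 1 \<le> m" "m \<le> n"
  shows "ext_vars (adder p r lo n m A B cin) \<subseteq> I \<union> adder_cells p r lo n m"
proof -
  let ?D = "adder_cells p r lo n m"
  let ?c = "\<lambda>j. if j = lo then cin else Wire (Carry p r j)"
  have c: "signal_vars (?c j) \<subseteq> I \<union> ?D" if "lo \<le> j" "j < n" for j
    using that assms(2,3) by (auto simp: adder_cells_def)
  have sums: "{Sum p r j} \<union> signal_vars (A j) \<union> signal_vars (B j) \<union> signal_vars (?c j) \<subseteq> I \<union> ?D"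
    if "j \<in> {lo..<n}" for j
    using that assms(1)[of j] c[of j] by (auto simp: adder_cells_def split del: if_split)
  have carries: "{Carry p r (Suc j)} \<union> signal_vars (A j) \<union> signal_vars (B j) \<union> signal_vars (?c j) \<subseteq> I \<union> ?D"
    if "j \<in> {lo..<m}" for j
    using that assms(1)[of j] assms(4) c[of j] by (auto simp: adder_cells_def split del: if_split)
  have eq: "ext_vars (adder p r lo n m A B cin) =
    (\<Union>j\<in>{lo..<n}. {Sum p r j} \<union> signal_vars (A j) \<union> signal_vars (B j) \<union> signal_vars (?c j)) \<union>
    (\<Union>j\<in>{lo..<m}. {Carry p r (Suc j)} \<union> signal_vars (A j) \<union> signal_vars (B j) \<union> signal_vars (?c j))"
    unfolding ext_vars_def adder_def Let_def sum_gate_def carry_gate_def set_append set_map UN_Un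
      set_upt image_image UN_simps prod.case by simp
  show ?thesis unfolding eq by (rule Un_least[OF UN_least[OF sums] UN_least[OF carries]])
qed

lemma card_adder_cells: "card (adder_cells p r lo n m) \<le> length (adder p r lo n m A B cin)"
proof -
  have "card (adder_cells p r lo n m) \<le> card {lo..<n} + card {Suc lo..m}"
    unfolding adder_cells_def by (intro order_trans[OF card_Un_le] add_mono card_image_le) auto
  then show ?thesis by (simp add: adder_def Let_def)
qed

lemma finite_adder_cells: "finite (adder_cells p r lo n m)"
  by (simp add: adder_cells_def)

lemma circuit_adder:
  assumes "\<And>j. lo \<le> j \<Longrightarrow> j < n \<Longrightarrow> signal_vars (A j) \<union> signal_vars (B j) \<subseteq> I"
    and "signal_vars cin \<subseteq> I" "n - 1 \<le> m" "m \<le> n" and I: "I \<inter> adder_cells p r lo n m = {}"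
  shows "circuit I (adder_cells p r lo n m) (adder p r lo n m A B cin)"
proof -
  have "\<exists>\<tau>. (\<forall>y. y \<notin> adder_cells p r lo n m \<longrightarrow> \<tau> y = \<sigma> y) \<and> ext_sat \<tau> (adder p r lo n m A B cin)" for \<sigma>
  proof -
    have "(signal_vars (A j) \<union> signal_vars (B j)) \<inter> adder_cells p r lo n m = {}" if "lo \<le> j" "j < n" for j
      using assms(1)[OF that] I by blast
    from this assms(3,4) obtain \<tau> where \<tau>: "\<And>y. y \<notin> adder_cells p r lo n m \<Longrightarrow> \<tau> y = \<sigma> y"
      "signal_val \<tau> cin = signal_val \<sigma> cin \<Longrightarrow> ext_sat \<tau> (adder p r lo n m A B cin)"
      by (rule adder_solution[where \<sigma> = \<sigma> and c = "signal_val \<sigma> cin"]) blast+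
    moreover have "signal_val \<tau> cin = signal_val \<sigma> cin"
      using assms(2) I by (intro signal_val_cong \<tau>(1)) blast
    ultimately show ?thesis by blast
  qed
  then show ?thesis unfolding circuit_def
    using ext_vars_adder[of lo n A B I cin p r m] assms
    by (simp add: ext_conjunctive_form_adder card_adder_cells finite_adder_cells le_supI1)
qed

text \<open>
  The carry out of an adder is monotone in its carry-in, so it has a fixed point.
\<close>

lemma circuit_end_around_adder:
  assumes "\<And>j. j < n \<Longrightarrow> signal_vars (A j) \<union> signal_vars (B j) \<subseteq> I"
    and "n \<ge> 1" and I: "I \<inter> adder_cells p r 0 n n = {}"
  shows "circuit I (adder_cells p r 0 n n) (adder p r 0 n n A B (Wire (Carry p r n)))"
proof -
  let ?F = "adder p r 0 n n A B (Wire (Carry p r n))"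
  have "\<exists>\<tau>. (\<forall>y. y \<notin> adder_cells p r 0 n n \<longrightarrow> \<tau> y = \<sigma> y) \<and> ext_sat \<tau> ?F" for \<sigma>
  proof -
    let ?rip = "ripple (\<lambda>j. signal_val \<sigma> (A j)) (\<lambda>j. signal_val \<sigma> (B j)) 0"
    \<comment> \<open>If carry-in \<open>False\<close> does not reproduce itself, it yields carry
      out \<open>True\<close>; by monotonicity carry-in \<open>True\<close> then yields
      \<open>True\<close> as well.\<close>
    obtain c where c: "?rip c n = c"
      using ripple_mono[of "\<lambda>j. signal_val \<sigma> (A j)" "\<lambda>j. signal_val \<sigma> (B j)" 0 n] by blast
    have "(signal_vars (A j) \<union> signal_vars (B j)) \<inter> adder_cells p r 0 n n = {}" if "0 \<le> j" "j < n" for j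
      using assms(1)[OF that(2)] I by blast
    then obtain \<tau> where \<tau>: "\<And>y. y \<notin> adder_cells p r 0 n n \<Longrightarrow> \<tau> y = \<sigma> y"
      "\<And>j. 0 < j \<Longrightarrow> j \<le> n \<Longrightarrow> \<tau> (Carry p r j) = ?rip c j"
      "signal_val \<tau> (Wire (Carry p r n)) = c \<Longrightarrow> ext_sat \<tau> ?F"
      by (rule adder_solution[where \<sigma> = \<sigma> and c = c and cin = "Wire (Carry p r n)"]) auto
    then show ?thesis using c \<open>n \<ge> 1\<close> by auto
  qed
  moreover have "Carry p r n \<in> adder_cells p r 0 n n"
    using \<open>n \<ge> 1\<close> by (auto simp: adder_cells_def)
  ultimately show ?thesis unfolding circuit_def
    using ext_vars_adder[of 0 n A B I "Wire (Carry p r n)" p r n] assms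
    by (simp add: ext_conjunctive_form_adder card_adder_cells finite_adder_cells)
qed

section \<open>Chains of adders and rows of bit products\<close>

definition sum_cells :: "part \<Rightarrow> nat \<Rightarrow> nat \<Rightarrow> var set" where
  "sum_cells p n R = (\<Union>r\<in>{1..<R}. adder_cells p r 0 n n)"

lemma adder_cells_disjoint: "s \<noteq> r \<Longrightarrow> adder_cells p s a b c \<inter> adder_cells p r d f g = {}"
  by (auto simp: adder_cells_def)

lemma acc_vars:
  assumes "\<And>r j. r < R \<Longrightarrow> j < n \<Longrightarrow> signal_vars (row r j) \<subseteq> I" "r < R" "j < n"
  shows "signal_vars (acc p row r j) \<subseteq> I \<union> sum_cells p n (Suc r)"
proof (cases "r = 0")
  case True
  then show ?thesis using assms by (auto simp: acc_def)
next
  case False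
  then have "Sum p r j \<in> adder_cells p r 0 n n" "r \<in> {1..<Suc r}"
    using assms by (auto simp: adder_cells_def)
  then show ?thesis using False by (auto simp: acc_def sum_cells_def)
qed

lemma circuit_sum_minus:
  assumes "\<And>r j. r < R \<Longrightarrow> j < n \<Longrightarrow> signal_vars (row r j) \<subseteq> I" and "n \<ge> 1" "I \<inter> sum_cells p n R = {}"
  shows "circuit I (sum_cells p n R) (sum_minus p n row R)"
  unfolding sum_minus_def sum_cells_def
proof (rule circuit_concat, rule circuit_end_around_adder)
  fix r assume r: "1 \<le> r" "r < R"
  show "signal_vars (acc p row (r - 1) j) \<union> signal_vars (row r j) \<subseteq> I \<union> (\<Union>s\<in>{1..<r}. adder_cells p s 0 n n)"
    if "j < n" for j
  proof -
    have "signal_vars (acc p row (r - 1) j) \<subseteq> I \<union> sum_cells p n (Suc (r - 1))"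
      by (rule acc_vars[OF assms(1)]) (use r that in auto)
    then show ?thesis using assms(1)[of r j] r that by (simp add: sum_cells_def le_supI1)
  qed
  show "(I \<union> (\<Union>s\<in>{1..<r}. adder_cells p s 0 n n)) \<inter> adder_cells p r 0 n n = {}"
  proof -
    have "adder_cells p r 0 n n \<subseteq> sum_cells p n R" unfolding sum_cells_def using r by (intro UN_upper) simp
    then have "I \<inter> adder_cells p r 0 n n = {}" using assms(3) by blast
    moreover have "adder_cells p s 0 n n \<inter> adder_cells p r 0 n n = {}" if "s \<in> {1..<r}" for s
      using that by (intro adder_cells_disjoint) auto
    ultimately show ?thesis by blast
  qed
qed (rule assms(2))

lemma circuit_sum_plus:
  assumes "\<And>r j. r < R \<Longrightarrow> j < n \<Longrightarrow> signal_vars (row r j) \<subseteq> I" and "signal_vars t \<subseteq> I"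
    and "n \<ge> 1" "I \<inter> sum_cells p n R = {}"
  shows "circuit I (sum_cells p n R) (sum_plus p n row t R)"
  unfolding sum_plus_def sum_cells_def
proof (rule circuit_concat, rule circuit_adder)
  fix r assume r: "1 \<le> r" "r < R"
  show "signal_vars (acc p row (r - 1) j) \<union> signal_vars (row r j) \<subseteq> I \<union> (\<Union>s\<in>{1..<r}. adder_cells p s 0 n n)"
    if "j < n" for j
  proof -
    have "signal_vars (acc p row (r - 1) j) \<subseteq> I \<union> sum_cells p n (Suc (r - 1))"
      by (rule acc_vars[OF assms(1)]) (use r that in auto)
    then show ?thesis using assms(1)[of r j] r that by (simp add: sum_cells_def le_supI1)
  qed
  have "Carry p (r - 1) n \<in> adder_cells p (r - 1) 0 n n"
    using \<open>n \<ge> 1\<close> by (auto simp: adder_cells_def)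
  then show "signal_vars (inv_signal (carry_plus p n t (r - 1))) \<subseteq> I \<union> (\<Union>s\<in>{1..<r}. adder_cells p s 0 n n)"
    using assms(2) r by (auto simp: carry_plus_def)
  show "(I \<union> (\<Union>s\<in>{1..<r}. adder_cells p s 0 n n)) \<inter> adder_cells p r 0 n n = {}"
  proof -
    have "adder_cells p r 0 n n \<subseteq> sum_cells p n R" unfolding sum_cells_def using r by (intro UN_upper) simp
    then have "I \<inter> adder_cells p r 0 n n = {}" using assms(4) by blast
    moreover have "adder_cells p s 0 n n \<inter> adder_cells p r 0 n n = {}" if "s \<in> {1..<r}" for s
      using that by (intro adder_cells_disjoint) auto
    ultimately show ?thesis by blast
  qed
qed auto

lemma circuit_and_rows:
  assumes "\<And>r j. r < m \<Longrightarrow> j \<in> set (xs r) \<Longrightarrow> signal_vars (a r j) \<union> signal_vars (b r j) \<subseteq> I"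
    and "\<And>r. r < m \<Longrightarrow> distinct (xs r)" "\<And>r j. And p r j \<notin> I"
  shows "circuit I (\<Union>r\<in>{0..<m}. And p r ` set (xs r))
    (concat (map (\<lambda>r. map (\<lambda>j. and_gate (And p r j) (a r j) (b r j)) (xs r)) [0..<m]))"
proof (rule circuit_concat, rule circuit_weaken, rule circuit_ands)
  fix r assume r: "r < m"
  show "distinct (xs r)" by (rule assms(2)[OF r])
  show "signal_vars (a r j) \<union> signal_vars (b r j) \<subseteq> I" if "j \<in> set (xs r)" for j
    by (rule assms(1)[OF r that])
  show "I \<inter> And p r ` set (xs r) = {}" using assms(3) by auto
  show "(I \<union> (\<Union>s\<in>{0..<r}. And p s ` set (xs s))) \<inter> And p r ` set (xs r) = {}"
    using assms(3) by auto
qed auto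

section \<open>The formula split into gates and comparisons\<close>

definition input_cells :: "nat \<Rightarrow> operand \<Rightarrow> var set" where
  "input_cells l z = Input z ` {..<l}"

text \<open>The gates are always solvable, whatever the inputs; the comparison is cut off because it
  alone can fail and alone mentions \<open>x\<close>.\<close>

definition mul_minus_gates :: "nat \<Rightarrow> nat \<Rightarrow> var ext_formula" where
  "mul_minus_gates i n =
     concat (map (\<lambda>r. map (\<lambda>j. and_gate (And (MulMinus i) r j) (minus_word i U r)
       (minus_word i V ((j + n - r) mod n))) [0..<n]) [0..<n]) @
     sum_minus (MulMinus i) n (\<lambda>r j. Wire (And (MulMinus i) r j)) n"

definition mul_minus_cells :: "nat \<Rightarrow> nat \<Rightarrow> var set" where
  "mul_minus_cells i n = (\<Union>r\<in>{0..<n}. And (MulMinus i) r ` set [0..<n]) \<union> sum_cells (MulMinus i) n n"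

definition plus_row :: "nat \<Rightarrow> nat \<Rightarrow> nat \<Rightarrow> word" where
  "plus_row i n r j = (if j < r \<and> r < n then Inv (And (MulPlus i) r j) else Wire (And (MulPlus i) r j))"

text \<open>The single gate is written as a \<open>map\<close> over \<open>[0]\<close> to fit
  \<open>circuit_ands\<close>, and the lists are nested to the left to fit nested uses of
  \<open>circuit_append\<close>.\<close>

definition mul_plus_gates :: "nat \<Rightarrow> nat \<Rightarrow> var ext_formula" where
  "mul_plus_gates i n =
     (((concat (map (\<lambda>r. map (\<lambda>j. and_gate (And (MulPlus i) r j) (plus_word i U r)
        (plus_word i V ((j + n - r) mod n))) [0..<n]) [0..<n]) @
      map (\<lambda>j. and_gate (And (MulPlus i) n j) (plus_extra i n V) (plus_word i U j)) [0..<n]) @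
      map (\<lambda>j. and_gate (And (MulPlus i) (n + 1) j) (plus_extra i n U) (plus_word i V j)) [0..<n]) @
      map (\<lambda>j. and_gate (And (MulPlus i) (n + 2) j) (plus_extra i n U) (plus_extra i n V)) [0]) @
      sum_plus (MulPlus i) n (plus_row i n) (Inv (And (MulPlus i) (n + 2) 0)) (n + 2)"

definition mul_plus_cells :: "nat \<Rightarrow> nat \<Rightarrow> var set" where
  "mul_plus_cells i n = (((\<Union>r\<in>{0..<n}. And (MulPlus i) r ` set [0..<n]) \<union>
     And (MulPlus i) n ` set [0..<n]) \<union> And (MulPlus i) (n + 1) ` set [0..<n]) \<union>
     And (MulPlus i) (n + 2) ` set [0] \<union> sum_cells (MulPlus i) n (n + 2)"

definition mul_pow_gates :: "nat \<Rightarrow> nat \<Rightarrow> var ext_formula" where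
  "mul_pow_gates l n =
     concat (map (\<lambda>r. map (\<lambda>j.
       and_gate (And MulPow r j) (input_word l U r) (input_word l V (j - r))) [r..<n]) [0..<n]) @
     concat (map (\<lambda>r.
       adder MulPow r r n (n - 1) (acc_pow (r - 1)) (\<lambda>j. Wire (And MulPow r j)) (Const False)) [1..<n])"

definition mul_pow_cells :: "nat \<Rightarrow> var set" where
  "mul_pow_cells n = (\<Union>r\<in>{0..<n}. And MulPow r ` set [r..<n]) \<union>
     (\<Union>r\<in>{1..<n}. adder_cells MulPow r r n (n - 1))"

definition compare_pow :: "nat \<Rightarrow> nat \<Rightarrow> var ext_formula" where
  "compare_pow n x = map (\<lambda>j. (signal_vars (acc_pow (n - 1) j),
     \<lambda>\<sigma>. signal_val \<sigma> (acc_pow (n - 1) j) = bit x j)) [0..<n]"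

lemma mul_minus_formula_eq:
  "mul_minus_formula i n x = mul_minus_gates i n @
     compare_minus n x (acc (MulMinus i) (\<lambda>r j. Wire (And (MulMinus i) r j)) (n - 1))"
  by (simp add: mul_minus_formula_def mul_minus_gates_def Let_def)

lemma mul_plus_formula_eq:
  "mul_plus_formula i n x = mul_plus_gates i n @
     compare_plus n ((x + 2 ^ n - 1) mod (2 ^ n + 1)) (acc (MulPlus i) (plus_row i n) (n + 1))
       (carry_plus (MulPlus i) n (Inv (And (MulPlus i) (n + 2) 0)) (n + 1))"
  by (simp add: mul_plus_formula_def mul_plus_gates_def Let_def plus_row_def[abs_def])

lemma mul_pow_formula_eq: "mul_pow_formula l n x = mul_pow_gates l n @ compare_pow n x"
  by (simp add: mul_pow_formula_def mul_pow_gates_def compare_pow_def)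

text \<open>Every computed variable names the part that computes it, so variable sets of different
  parts are seen to be disjoint by comparing these names; inputs belong to no part.\<close>

fun var_part :: "var \<Rightarrow> part option" where
  "var_part (Input z j) = None"
| "var_part (And p r j) = Some p"
| "var_part (Sum p r j) = Some p"
| "var_part (Carry p r j) = Some p"

text \<open>The other parts of the formula use indices from 1 on, so the value 0 keeps
  \<open>MulPow\<close> apart from all of them.\<close>

fun part_index :: "part \<Rightarrow> nat" where
  "part_index (Fold i z) = i"
| "part_index (Minus i z) = i"
| "part_index (Plus i z) = i"
| "part_index (MulMinus i) = i"
| "part_index (MulPlus i) = i"
| "part_index MulPow = 0"

lemma adder_cells_part: "y \<in> adder_cells p r lo n m \<Longrightarrow> var_part y = Some p"
  by (auto simp: adder_cells_def)

lemma sum_cells_part: "y \<in> sum_cells p n R \<Longrightarrow> var_part y = Some p"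
  by (auto simp: sum_cells_def dest: adder_cells_part)

lemma input_cells_part: "y \<in> input_cells l z \<Longrightarrow> var_part y = None"
  by (auto simp: input_cells_def)

lemma mul_minus_cells_part: "y \<in> mul_minus_cells i n \<Longrightarrow> var_part y = Some (MulMinus i)"
  by (auto simp: mul_minus_cells_def dest: sum_cells_part)

lemma mul_plus_cells_part: "y \<in> mul_plus_cells i n \<Longrightarrow> var_part y = Some (MulPlus i)"
  by (auto simp: mul_plus_cells_def dest: sum_cells_part)

lemma mul_pow_cells_part: "y \<in> mul_pow_cells n \<Longrightarrow> var_part y = Some MulPow"
  by (auto simp: mul_pow_cells_def dest: adder_cells_part)

lemmas cells_part = adder_cells_part sum_cells_part input_cells_part mul_minus_cells_part
  mul_plus_cells_part mul_pow_cells_part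

lemma and_notin_sum_cells: "And p r j \<notin> sum_cells q n R"
  by (auto simp: sum_cells_def adder_cells_def)

lemma disjoint_parts:
  "(\<And>y z. y \<in> A \<Longrightarrow> z \<in> B \<Longrightarrow> var_part y \<noteq> var_part z) \<Longrightarrow> A \<inter> B = {}"
  by blast

section \<open>Solvability of the gates of each part\<close>

lemma input_word_vars: "signal_vars (input_word l z j) \<subseteq> input_cells l z"
  by (auto simp: input_word_def input_cells_def)

lemma circuit_mul_pow:
  "circuit (input_cells l U \<union> input_cells l V) (mul_pow_cells n) (mul_pow_gates l n)"
  unfolding mul_pow_gates_def mul_pow_cells_def
proof (rule circuit_append[OF _ circuit_concat subset_refl])
  let ?I = "input_cells l U \<union> input_cells l V"
  let ?A = "\<Union>r\<in>{0..<n}. And MulPow r ` set [r..<n]"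
  show "circuit ?I ?A (concat (map (\<lambda>r. map (\<lambda>j.
       and_gate (And MulPow r j) (input_word l U r) (input_word l V (j - r))) [r..<n]) [0..<n]))"
    using input_word_vars[of l] by (intro circuit_and_rows) (auto simp: input_cells_def)
  show "(?I \<union> ?A) \<inter> (\<Union>r\<in>{1..<n}. adder_cells MulPow r r n (n - 1)) = {}"
    by (auto simp: input_cells_def adder_cells_def)
  fix r assume r: "1 \<le> r" "r < n"
  let ?J = "?I \<union> ?A \<union> (\<Union>s\<in>{1..<r}. adder_cells MulPow s s n (n - 1))"
  show "circuit ?J (adder_cells MulPow r r n (n - 1)) (adder MulPow r r n (n - 1) (acc_pow (r - 1))
      (\<lambda>j. Wire (And MulPow r j)) (Const False))"
  proof (rule circuit_adder)
    fix j assume j: "r \<le> j" "j < n"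
    have A: "And MulPow s j \<in> ?A" if "s \<le> j" for s
      by (rule UN_I[of s]) (use that j in auto)
    have "signal_vars (Wire (And MulPow r j)) \<subseteq> ?J" using A[of r] j by auto
    moreover have "signal_vars (acc_pow (r - 1) j) \<subseteq> ?J"
    \<comment> \<open>The first adder takes row 0 of the bit products as its accumulator; later ones
      take the sum bits of the adder before, which at positions \<open>j >= r\<close> is row
      \<open>r - 1\<close>.\<close>
    proof (cases "r = 1")
      case True
      then show ?thesis using A[of 0] by (simp add: acc_pow_def)
    next
      case False
      then have "Sum MulPow (r - 1) j \<in> adder_cells MulPow (r - 1) (r - 1) n (n - 1)" "r - 1 \<in> {1..<r}"
        using r j by (auto simp: adder_cells_def)
      then have "Sum MulPow (r - 1) j \<in> ?J" by (intro UnI2 UN_I)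
      moreover have "signal_vars (acc_pow (r - 1) j) = {Sum MulPow (r - 1) j}"
        using False r j by (simp add: acc_pow_def)
      ultimately show ?thesis by (simp only: insert_subset empty_subsetI simp_thms)
    qed
    ultimately show "signal_vars (acc_pow (r - 1) j) \<union> signal_vars (Wire (And MulPow r j)) \<subseteq> ?J"
      by (rule Un_least[rotated])
  next
    have "adder_cells MulPow s s n (n - 1) \<inter> adder_cells MulPow r r n (n - 1) = {}" if "s \<in> {1..<r}" for s
      using that by (intro adder_cells_disjoint) auto
    moreover have "(?I \<union> ?A) \<inter> adder_cells MulPow r r n (n - 1) = {}"
      by (auto simp: input_cells_def adder_cells_def)
    ultimately show "?J \<inter> adder_cells MulPow r r n (n - 1) = {}" by blast
  qed auto
qed

definition fold_cells :: "nat \<Rightarrow> nat \<Rightarrow> nat \<Rightarrow> operand \<Rightarrow> var set" where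
  "fold_cells l i n z = sum_cells (Fold i z) (2 * n) (fold_count l n)"

lemma circuit_fold:
  assumes "n \<ge> 1"
  shows "circuit (input_cells l z) (fold_cells l i n z) (fold_formula l i n z)"
  unfolding fold_formula_def fold_cells_def
  using assms input_word_vars[of l z]
  by (intro circuit_sum_minus disjoint_parts) (auto simp: fold_rows_def dest!: cells_part)

lemma fold_count_pos: "l \<ge> 1 \<Longrightarrow> n \<ge> 1 \<Longrightarrow> fold_count l n \<ge> 1"
  by (simp add: fold_count_def div_greater_zero_iff Suc_le_eq)

lemma fold_word_vars:
  assumes "l \<ge> 1" "n \<ge> 1" "j < 2 * n"
  shows "signal_vars (fold_word l i n z j) \<subseteq> input_cells l z \<union> fold_cells l i n z"
proof -
  have "signal_vars (fold_word l i n z j) \<subseteq>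
    input_cells l z \<union> sum_cells (Fold i z) (2 * n) (Suc (fold_count l n - 1))"
    unfolding fold_word_def using assms fold_count_pos[OF assms(1,2)]
    by (intro acc_vars[of "fold_count l n"]) (auto simp: fold_rows_def intro: subsetD[OF input_word_vars])
  then show ?thesis using fold_count_pos[OF assms(1,2)] by (simp add: fold_cells_def)
qed

lemma circuit_minus:
  assumes "l \<ge> 1" "n \<ge> 1"
  shows "circuit (input_cells l z \<union> fold_cells l i n z) (sum_cells (Minus i z) n 2) (minus_formula l i n z)"
  unfolding minus_formula_def
proof (rule circuit_sum_minus)
  fix r j :: nat assume "r < 2" "j < n"
  then have "r = 0 \<or> r = 1" by auto
  then have "r * n + j < 2 * n" using \<open>j < n\<close> by auto
  then show "signal_vars (fold_word l i n z (r * n + j)) \<subseteq> input_cells l z \<union> fold_cells l i n z"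
    using assms by (intro fold_word_vars)
next
  show "(input_cells l z \<union> fold_cells l i n z) \<inter> sum_cells (Minus i z) n 2 = {}"
    by (intro disjoint_parts) (auto simp: fold_cells_def dest!: cells_part)
qed (rule assms(2))

lemma circuit_plus:
  assumes "l \<ge> 1" "n \<ge> 1"
  shows "circuit (input_cells l z \<union> fold_cells l i n z) (sum_cells (Plus i z) n 2) (plus_formula l i n z)"
  unfolding plus_formula_def
proof (rule circuit_sum_plus)
  fix r j :: nat assume "r < 2" "j < n"
  then show "signal_vars (if r = 0 then fold_word l i n z j else inv_signal (fold_word l i n z (n + j)))
      \<subseteq> input_cells l z \<union> fold_cells l i n z"
    using fold_word_vars[of l n j i z] fold_word_vars[of l n "n + j" i z] assms by simp
next
  show "(input_cells l z \<union> fold_cells l i n z) \<inter> sum_cells (Plus i z) n 2 = {}"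
    by (intro disjoint_parts) (auto simp: fold_cells_def dest!: cells_part)
qed (use assms in auto)

lemma Sum_in_cells: "1 \<le> r \<Longrightarrow> r < R \<Longrightarrow> j < n \<Longrightarrow> Sum p r j \<in> sum_cells p n R"
  unfolding sum_cells_def by (rule UN_I[of r]) (auto simp: adder_cells_def)

lemma Carry_in_cells: "1 \<le> r \<Longrightarrow> r < R \<Longrightarrow> 1 \<le> n \<Longrightarrow> Carry p r n \<in> sum_cells p n R"
  unfolding sum_cells_def by (rule UN_I[of r]) (auto simp: adder_cells_def)

lemma circuit_mul_minus:
  assumes "n \<ge> 1"
  shows "circuit (sum_cells (Minus i U) n 2 \<union> sum_cells (Minus i V) n 2) (mul_minus_cells i n)
    (mul_minus_gates i n)"
  unfolding mul_minus_gates_def mul_minus_cells_def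
proof (rule circuit_append[OF circuit_and_rows circuit_sum_minus subset_refl])
  let ?I = "sum_cells (Minus i U) n 2 \<union> sum_cells (Minus i V) n 2"
  let ?A = "\<Union>r\<in>{0..<n}. And (MulMinus i) r ` set [0..<n]"
  have "?I \<inter> sum_cells (MulMinus i) n n = {}" by (auto dest!: cells_part)
  moreover have "?A \<inter> sum_cells (MulMinus i) n n = {}" by (auto simp: and_notin_sum_cells)
  ultimately show "(?I \<union> ?A) \<inter> sum_cells (MulMinus i) n n = {}"
    by (simp only: Int_Un_distrib2 Un_empty_left)
  then show "(?I \<union> ?A) \<inter> sum_cells (MulMinus i) n n = {}" .
  show "signal_vars (Wire (And (MulMinus i) r j)) \<subseteq> ?I \<union> ?A" if "r < n" "j < n" for r j
    using UN_I[of r "{0..<n}" "And (MulMinus i) r j"] that by auto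
qed (use assms in \<open>auto simp: minus_word_def and_notin_sum_cells Sum_in_cells\<close>)

lemma plus_row_vars:
  assumes r: "r < n + 2" "j < n"
  shows "signal_vars (plus_row i n r j) \<subseteq> (((\<Union>r\<in>{0..<n}. And (MulPlus i) r ` set [0..<n]) \<union>
     And (MulPlus i) n ` set [0..<n]) \<union> And (MulPlus i) (n + 1) ` set [0..<n]) \<union>
     And (MulPlus i) (n + 2) ` set [0]" (is "_ \<subseteq> ?A")
proof -
  consider "r < n" | "r = n" | "r = n + 1" using r by linarith
  then have "And (MulPlus i) r j \<in> ?A"
  proof cases
    case 1
    have "And (MulPlus i) r j \<in> (\<Union>r\<in>{0..<n}. And (MulPlus i) r ` set [0..<n])"
      by (rule UN_I[of r]) (use 1 r in auto)
    then show ?thesis by blast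
  qed (use r in auto)
  then show ?thesis by (auto simp: plus_row_def simp del: set_upt)
qed

lemma circuit_mul_plus:
  assumes "n \<ge> 1"
  shows "circuit (sum_cells (Plus i U) n 2 \<union> sum_cells (Plus i V) n 2) (mul_plus_cells i n)
    (mul_plus_gates i n)"
  unfolding mul_plus_gates_def mul_plus_cells_def
proof (rule circuit_append[OF circuit_append[OF circuit_append[OF circuit_append[OF circuit_and_rows
      circuit_ands subset_refl] circuit_ands subset_refl] circuit_ands subset_refl] circuit_sum_plus subset_refl])
  let ?I = "sum_cells (Plus i U) n 2 \<union> sum_cells (Plus i V) n 2"
  let ?p = "MulPlus i"
  let ?A = "(((\<Union>r\<in>{0..<n}. And ?p r ` set [0..<n]) \<union>
     And ?p n ` set [0..<n]) \<union> And ?p (n + 1) ` set [0..<n]) \<union> And ?p (n + 2) ` set [0]"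
  have "?I \<inter> sum_cells ?p n (n + 2) = {}" by (auto dest!: cells_part)
  moreover have "?A \<inter> sum_cells ?p n (n + 2) = {}" by (auto simp: and_notin_sum_cells)
  ultimately show "(?I \<union> ?A) \<inter> sum_cells ?p n (n + 2) = {}"
    by (simp only: Int_Un_distrib2 Un_empty_left)
  then show "(?I \<union> ?A) \<inter> sum_cells ?p n (n + 2) = {}" .
  show "signal_vars (plus_row i n r j) \<subseteq> ?I \<union> ?A" if "r < n + 2" "j < n" for r j
    using plus_row_vars[OF that, of i] by (rule le_supI2)
qed (use assms in \<open>auto simp: plus_word_def plus_extra_def and_notin_sum_cells
    Sum_in_cells Carry_in_cells\<close>)

section \<open>Solvability of all gates together\<close>

definition residue_gates :: "nat \<Rightarrow> nat \<Rightarrow> nat \<Rightarrow> var ext_formula" where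
  "residue_gates l i n =
     ((((((fold_formula l i n U @ fold_formula l i n V) @
     minus_formula l i n U) @ minus_formula l i n V) @ mul_minus_gates i n) @
     plus_formula l i n U) @ plus_formula l i n V) @ mul_plus_gates i n"

definition residue_cells :: "nat \<Rightarrow> nat \<Rightarrow> nat \<Rightarrow> var set" where
  "residue_cells l i n =
     ((((((fold_cells l i n U \<union> fold_cells l i n V) \<union>
     sum_cells (Minus i U) n 2) \<union> sum_cells (Minus i V) n 2) \<union> mul_minus_cells i n) \<union>
     sum_cells (Plus i U) n 2) \<union> sum_cells (Plus i V) n 2) \<union> mul_plus_cells i n"

lemma fold_cells_part: "y \<in> fold_cells l i n z \<Longrightarrow> var_part y = Some (Fold i z)"
  by (auto simp: fold_cells_def dest: sum_cells_part)

lemma circuit_residue: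
  assumes "l \<ge> 1" "n \<ge> 1"
  shows "circuit (input_cells l U \<union> input_cells l V) (residue_cells l i n) (residue_gates l i n)"
  unfolding residue_gates_def residue_cells_def
proof -
  \<comment> \<open>\<open>circuit_append\<close> keeps the input set of its first circuit, so the
    inputs of \<open>V\<close> have to be declared already here.\<close>
  have U: "circuit (input_cells l U \<union> input_cells l V) (fold_cells l i n U) (fold_formula l i n U)"
    by (rule circuit_weaken[OF circuit_fold[OF assms(2)]], simp, rule disjoint_parts)
      (auto dest!: cells_part fold_cells_part)
  note V = circuit_fold[OF assms(2)]
    and minus = circuit_minus[OF assms] and mul_minus = circuit_mul_minus[OF assms(2)]
    and plus = circuit_plus[OF assms] and mul_plus = circuit_mul_plus[OF assms(2)]
  note c = circuit_append
  show "circuit (input_cells l U \<union> input_cells l V)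
     (((((((fold_cells l i n U \<union> fold_cells l i n V) \<union>
     sum_cells (Minus i U) n 2) \<union> sum_cells (Minus i V) n 2) \<union> mul_minus_cells i n) \<union>
     sum_cells (Plus i U) n 2) \<union> sum_cells (Plus i V) n 2) \<union> mul_plus_cells i n)
     (((((((fold_formula l i n U @ fold_formula l i n V) @
     minus_formula l i n U) @ minus_formula l i n V) @ mul_minus_gates i n) @
     plus_formula l i n U) @ plus_formula l i n V) @ mul_plus_gates i n)"
    by (rule c[OF c[OF c[OF c[OF c[OF c[OF c[OF U V] minus] minus] mul_minus] plus] plus] mul_plus])
      ((rule disjoint_parts; auto dest!: cells_part fold_cells_part) | blast)+
qed

definition gates :: "nat \<Rightarrow> nat \<Rightarrow> (nat \<Rightarrow> nat) \<Rightarrow> var ext_formula" where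
  "gates l k e = mul_pow_gates l (e 0) @ concat (map (\<lambda>i. residue_gates l i (e i)) [1..<Suc k])"

definition gate_cells :: "nat \<Rightarrow> nat \<Rightarrow> (nat \<Rightarrow> nat) \<Rightarrow> var set" where
  "gate_cells l k e = mul_pow_cells (e 0) \<union> (\<Union>i\<in>{1..<Suc k}. residue_cells l i (e i))"

lemma residue_cells_part:
  "y \<in> residue_cells l i n \<Longrightarrow> \<exists>p. var_part y = Some p \<and> part_index p = i"
  by (auto simp: residue_cells_def dest!: cells_part fold_cells_part)

lemma circuit_gates:
  assumes "l \<ge> 1" "\<forall>i\<le>k. e i \<ge> 1"
  shows "circuit (input_cells l U \<union> input_cells l V) (gate_cells l k e) (gates l k e)"
  unfolding gates_def gate_cells_def
proof (rule circuit_append[OF circuit_mul_pow circuit_concat subset_refl])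
  let ?I = "input_cells l U \<union> input_cells l V"
  let ?D = "mul_pow_cells (e 0)"
  show "(?I \<union> ?D) \<inter> (\<Union>i\<in>{1..<Suc k}. residue_cells l i (e i)) = {}"
    by (auto dest!: cells_part residue_cells_part)
  fix i assume i: "1 \<le> i" "i < Suc k"
  show "circuit (?I \<union> ?D \<union> (\<Union>s\<in>{1..<i}. residue_cells l s (e s))) (residue_cells l i (e i))
      (residue_gates l i (e i))"
  proof (rule circuit_weaken[OF circuit_residue])
    show "(?I \<union> ?D \<union> (\<Union>s\<in>{1..<i}. residue_cells l s (e s))) \<inter> residue_cells l i (e i) = {}"
      using i by (auto dest!: cells_part residue_cells_part)
  qed (use i assms in auto)
qed

section \<open>Values of words\<close>

definition word_val :: "var assignment \<Rightarrow> nat \<Rightarrow> word \<Rightarrow> nat" where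
  "word_val \<sigma> n A = (\<Sum>j<n. of_bool (signal_val \<sigma> (A j)) * 2 ^ j)"

lemma bit_word_val: "bit (word_val \<sigma> n A) j \<longleftrightarrow> j < n \<and> signal_val \<sigma> (A j)"
proof -
  have "word_val \<sigma> n A = horner_sum of_bool 2 (map (\<lambda>j. signal_val \<sigma> (A j)) [0..<n])"
    by (simp add: horner_sum_eq_sum word_val_def atLeast0LessThan)
  then show ?thesis by (auto simp: bit_horner_sum_bit_iff)
qed

lemma word_val_less: "word_val \<sigma> n A < 2 ^ n"
proof (induction n)
  case (Suc n)
  have "word_val \<sigma> (Suc n) A = word_val \<sigma> n A + of_bool (signal_val \<sigma> (A n)) * 2 ^ n"
    by (simp add: word_val_def)
  then show ?case using Suc by (auto simp: of_bool_def)
qed (simp add: word_val_def)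

lemma word_val_eq_iff:
  assumes "y < 2 ^ n"
  shows "word_val \<sigma> n A = y \<longleftrightarrow> (\<forall>j<n. signal_val \<sigma> (A j) = bit y j)"
proof -
  have "bit y j \<Longrightarrow> j < n" for j
    using assms by (metis bit_take_bit_iff take_bit_nat_eq_self)
  then show ?thesis unfolding bit_eq_iff bit_word_val by auto
qed

lemma word_val_cong:
  "(\<And>j. j < n \<Longrightarrow> signal_val \<sigma> (A j) = signal_val \<tau> (B j)) \<Longrightarrow> word_val \<sigma> n A = word_val \<tau> n B"
  by (simp add: word_val_def)

lemma word_val_split: "word_val \<sigma> (m + n) A = word_val \<sigma> m A + 2 ^ m * word_val \<sigma> n (\<lambda>j. A (m + j))"
  by (induction n) (simp_all add: word_val_def power_add algebra_simps)

lemma word_val_complement: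
  assumes "\<And>j. j < n \<Longrightarrow> signal_val \<sigma> (B j) = (\<not> signal_val \<sigma> (A j))"
  shows "word_val \<sigma> n A + word_val \<sigma> n B + 1 = 2 ^ n"
  using assms
proof (induction n)
  case (Suc n)
  have "word_val \<sigma> (Suc n) A + word_val \<sigma> (Suc n) B + 1 = (word_val \<sigma> n A + word_val \<sigma> n B + 1) + 2 ^ n"
    using Suc.prems[of n] by (cases "signal_val \<sigma> (A n)") (simp_all add: word_val_def)
  then show ?case using Suc by simp
qed (simp add: word_val_def)

lemma word_val_and:
  assumes "\<And>j. j < n \<Longrightarrow> signal_val \<sigma> (B j) = (b \<and> signal_val \<sigma> (A j))"
  shows "word_val \<sigma> n B = of_bool b * word_val \<sigma> n A"
  using assms by (simp add: word_val_def sum_distrib_left)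

text \<open>The cut separates the top \<open>r\<close> bits, which a shift by \<open>r\<close>
  pushes to weight \<open>2 ^ n\<close> and beyond, from the bits that stay below.\<close>

lemma word_val_rotate:
  assumes "r < n"
  shows "word_val \<sigma> n A = word_val \<sigma> (n - r) A + 2 ^ (n - r) * word_val \<sigma> r (\<lambda>j. A (n - r + j))"
  using word_val_split[of \<sigma> "n - r" r A] assms by simp

lemma pow_cong_1: "[2 ^ n = 1] (mod (2 ^ n - 1 :: nat))"
  by (simp add: cong_altdef_nat)

text \<open>Since \<open>2 ^ n\<close> is congruent to 1, the carry out counts as \<open>c\<close>
  and cancels against the same \<open>c\<close> fed in. The argument works for either fixed point of
  the carry.\<close>

lemma end_around_cong:
  fixes a b c s :: nat
  assumes "s + 2 ^ n * c = a + b + c"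
  shows "[s = a + b] (mod (2 ^ n - 1))"
proof -
  have "[s + c = s + 2 ^ n * c] (mod (2 ^ n - 1))"
    using cong_mult[OF pow_cong_1[of n] cong_refl[of c]] by (intro cong_add cong_refl) (simp add: cong_sym)
  then have "[s + c = (a + b) + c] (mod (2 ^ n - 1))" using assms by simp
  then show ?thesis by (simp only: cong_add_rcancel_nat)
qed

section \<open>Correctness of the adders\<close>

lemma ext_satD: "ext_sat \<sigma> F \<Longrightarrow> (S, P) \<in> set F \<Longrightarrow> P \<sigma>"
  by (auto simp: ext_sat_def)

lemma adder_sum_bit:
  assumes "ext_sat \<sigma> (adder p r lo n m A B cin)" "lo \<le> j" "j < n"
  shows "\<sigma> (Sum p r j) = odd (of_bool (signal_val \<sigma> (A j)) + of_bool (signal_val \<sigma> (B j))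
    + of_bool (signal_val \<sigma> (if j = lo then cin else Wire (Carry p r j))) :: nat)"
proof -
  have "sum_gate (Sum p r j) (A j) (B j) (if j = lo then cin else Wire (Carry p r j))
      \<in> set (adder p r lo n m A B cin)"
    unfolding adder_def Let_def set_append set_map
    by (rule UnI1, rule image_eqI[of _ _ j]) (use assms(2,3) in auto)
  from ext_satD[OF assms(1) this[unfolded sum_gate_def]] show ?thesis .
qed

lemma adder_carry_bit:
  assumes "ext_sat \<sigma> (adder p r lo n m A B cin)" "lo \<le> j" "j < m"
  shows "\<sigma> (Carry p r (Suc j)) = (of_bool (signal_val \<sigma> (A j)) + of_bool (signal_val \<sigma> (B j))
    + of_bool (signal_val \<sigma> (if j = lo then cin else Wire (Carry p r j))) \<ge> (2 :: nat))"
proof -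
  have "carry_gate (Carry p r (Suc j)) (A j) (B j) (if j = lo then cin else Wire (Carry p r j))
      \<in> set (adder p r lo n m A B cin)"
    unfolding adder_def Let_def set_append set_map
    by (rule UnI2, rule image_eqI[of _ _ j]) (use assms(2,3) in auto)
  from ext_satD[OF assms(1) this[unfolded carry_gate_def]] show ?thesis .
qed

lemma full_adder:
  "of_bool (odd (of_bool a + of_bool b + of_bool c :: nat))
     + 2 * of_bool (of_bool a + of_bool b + of_bool c \<ge> (2 :: nat))
   = of_bool a + of_bool b + (of_bool c :: nat)"
  by (cases a; cases b; cases c) simp_all

text \<open>Invariant of ripple-carry addition: after the positions below \<open>k\<close>, the
  pending carry is still worth \<open>2 ^ k\<close>. Each step trades it for a sum bit and the next
  carry by \<open>full_adder\<close>.\<close>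

lemma adder_prefix:
  assumes F: "ext_sat \<sigma> (adder p r lo n m A B cin)" and "lo \<le> k" "k \<le> m" "m \<le> n"
  shows "(\<Sum>j=lo..<k. of_bool (\<sigma> (Sum p r j)) * 2 ^ j)
      + 2 ^ k * of_bool (signal_val \<sigma> (if k = lo then cin else Wire (Carry p r k)))
    = (\<Sum>j=lo..<k. of_bool (signal_val \<sigma> (A j)) * 2 ^ j) + (\<Sum>j=lo..<k. of_bool (signal_val \<sigma> (B j)) * 2 ^ j)
      + (2 ^ lo * of_bool (signal_val \<sigma> cin) :: nat)"
  using assms(2,3)
proof (induction k rule: dec_induct)
  case (step k)
  let ?c = "signal_val \<sigma> (if k = lo then cin else Wire (Carry p r k))"
  have "of_bool (\<sigma> (Sum p r k)) + 2 * of_bool (\<sigma> (Carry p r (Suc k)))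
      = of_bool (signal_val \<sigma> (A k)) + of_bool (signal_val \<sigma> (B k)) + (of_bool ?c :: nat)"
    using adder_sum_bit[OF F, of k] adder_carry_bit[OF F, of k] step.hyps step.prems assms(4)
    by (simp only: full_adder)
  then have "2 ^ k * of_bool (\<sigma> (Sum p r k)) + 2 ^ Suc k * of_bool (\<sigma> (Carry p r (Suc k)))
      = 2 ^ k * of_bool (signal_val \<sigma> (A k)) + 2 ^ k * of_bool (signal_val \<sigma> (B k)) + (2 ^ k * of_bool ?c :: nat)"
    by (metis (no_types, opaque_lifting) distrib_left mult.assoc power_Suc2)
  moreover have "Suc k \<noteq> lo" using step.hyps by simp
  ultimately show ?case using step.IH step.hyps step.prems
    by (simp add: algebra_simps split del: if_split)
qed simp

lemma adder_word:
  assumes "ext_sat \<sigma> (adder p r 0 n n A B cin)" "n \<ge> 1"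
  shows "word_val \<sigma> n (\<lambda>j. Wire (Sum p r j)) + 2 ^ n * of_bool (\<sigma> (Carry p r n))
    = word_val \<sigma> n A + word_val \<sigma> n B + of_bool (signal_val \<sigma> cin)"
  using adder_prefix[OF assms(1), of n] assms(2)
  by (simp add: word_val_def atLeast0LessThan)

text \<open>The carry out of the top position has no variable, so \<open>adder_prefix\<close>
  reaches only position \<open>n - 1\<close>. The last position is added by hand with
  \<open>?q\<close> as the missing carry, whose weight \<open>2 ^ n\<close> vanishes.\<close>

lemma adder_mod:
  assumes F: "ext_sat \<sigma> (adder p r lo n (n - 1) A B (Const False))" and "lo < n"
  shows "[(\<Sum>j=lo..<n. of_bool (\<sigma> (Sum p r j)) * 2 ^ j) =
    (\<Sum>j=lo..<n. of_bool (signal_val \<sigma> (A j)) * 2 ^ j) + (\<Sum>j=lo..<n. of_bool (signal_val \<sigma> (B j)) * 2 ^ j)]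
    (mod (2 ^ n :: nat))"
proof -
  obtain k where n: "n = Suc k" using assms(2) by (cases n) auto
  have k: "lo \<le> k" using assms(2) n by simp
  let ?c = "signal_val \<sigma> (if k = lo then Const False else Wire (Carry p r k))"
  let ?q = "of_bool (of_bool (signal_val \<sigma> (A k)) + of_bool (signal_val \<sigma> (B k)) + of_bool ?c \<ge> (2 :: nat)) :: nat"
  let ?S = "\<lambda>k. \<Sum>j=lo..<k. of_bool (\<sigma> (Sum p r j)) * 2 ^ j :: nat"
  let ?A = "\<lambda>k. \<Sum>j=lo..<k. of_bool (signal_val \<sigma> (A j)) * 2 ^ j :: nat"
  let ?B = "\<lambda>k. \<Sum>j=lo..<k. of_bool (signal_val \<sigma> (B j)) * 2 ^ j :: nat"
  have "?S k + 2 ^ k * of_bool ?c = ?A k + ?B k"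
    using adder_prefix[OF F, of k] n k by (simp split del: if_split)
  moreover have "of_bool (\<sigma> (Sum p r k)) + 2 * ?q
      = of_bool (signal_val \<sigma> (A k)) + of_bool (signal_val \<sigma> (B k)) + (of_bool ?c :: nat)"
    using adder_sum_bit[OF F k] n by (simp only: full_adder lessI)
  then have "2 ^ k * of_bool (\<sigma> (Sum p r k)) + 2 ^ Suc k * ?q
      = 2 ^ k * of_bool (signal_val \<sigma> (A k)) + 2 ^ k * of_bool (signal_val \<sigma> (B k)) + (2 ^ k * of_bool ?c :: nat)"
    by (metis (no_types, opaque_lifting) distrib_left mult.assoc power_Suc2)
  ultimately have "?S n + 2 ^ n * ?q = ?A n + ?B n"
    unfolding n using k by (simp add: mult.commute split del: if_split)
  moreover have "[?S n = ?S n + 2 ^ n * ?q] (mod 2 ^ n)"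
    by (simp add: cong_def)
  ultimately show ?thesis by simp
qed

lemma acc_Suc: "acc p row (Suc r) = (\<lambda>j. Wire (Sum p (Suc r) j))"
  by (simp add: acc_def)

lemma sum_minus_correct:
  assumes "ext_sat \<sigma> (sum_minus p n row R)" "n \<ge> 1" "r < R"
  shows "[word_val \<sigma> n (acc p row r) = (\<Sum>s\<le>r. word_val \<sigma> n (row s))] (mod (2 ^ n - 1))"
  using assms(3)
proof (induction r)
  case 0
  then show ?case by (simp add: acc_def)
next
  case (Suc r)
  have "ext_sat \<sigma> (adder p (Suc r) 0 n n (acc p row r) (row (Suc r)) (Wire (Carry p (Suc r) n)))"
    using assms(1) Suc.prems by (force simp: sum_minus_def ext_sat_concat)
  from adder_word[OF this assms(2)]
  have "[word_val \<sigma> n (\<lambda>j. Wire (Sum p (Suc r) j)) = word_val \<sigma> n (acc p row r) + word_val \<sigma> n (row (Suc r))]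
      (mod (2 ^ n - 1))" (is "[_ = ?b] (mod _)")
    by (intro end_around_cong[where c = "of_bool (\<sigma> (Carry p (Suc r) n))"]) simp
  also have "[?b = (\<Sum>s\<le>r. word_val \<sigma> n (row s)) + word_val \<sigma> n (row (Suc r))] (mod (2 ^ n - 1))"
    using Suc by (intro cong_add cong_refl) simp
  finally show ?case by (simp add: acc_Suc)
qed

text \<open>Stated over the integers because word minus carry is -1 for the zero word with carry
  set. The term \<open>int r\<close> arises because each adder is fed \<open>1 - t\<close> in place
  of \<open>- t\<close>.\<close>

lemma sum_plus_correct:
  assumes "ext_sat \<sigma> (sum_plus p n row t R)" "n \<ge> 1" "r < R"
  shows "[int (word_val \<sigma> n (acc p row r)) - of_bool (signal_val \<sigma> (carry_plus p n t r))
    = (\<Sum>s\<le>r. int (word_val \<sigma> n (row s))) + int r - of_bool (signal_val \<sigma> t)] (mod (2 ^ n + 1))"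
  using assms(3)
proof (induction r)
  case 0
  then show ?case by (simp add: acc_def carry_plus_def)
next
  case (Suc r)
  let ?c = "\<lambda>r. of_bool (signal_val \<sigma> (carry_plus p n t r)) :: int"
  have "ext_sat \<sigma> (adder p (Suc r) 0 n n (acc p row r) (row (Suc r)) (inv_signal (carry_plus p n t r)))"
    using assms(1) Suc.prems by (force simp: sum_plus_def ext_sat_concat)
  from arg_cong[OF adder_word[OF this assms(2)], of int]
  have "int (word_val \<sigma> n (acc p row (Suc r))) + 2 ^ n * ?c (Suc r)
      = int (word_val \<sigma> n (acc p row r)) + int (word_val \<sigma> n (row (Suc r))) + (1 - ?c r)"
    by (simp add: acc_Suc carry_plus_def of_bool_not_iff)
  \<comment> \<open>The carry out, worth \<open>2 ^ n\<close>, is split into the modulus times the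
    carry minus the carry itself.\<close>
  then have eq: "int (word_val \<sigma> n (acc p row (Suc r))) - ?c (Suc r)
      = int (word_val \<sigma> n (acc p row r)) - ?c r + (int (word_val \<sigma> n (row (Suc r))) + 1)
        + (2 ^ n + 1) * (- ?c (Suc r))"
    by (simp add: algebra_simps)
  have "[int (word_val \<sigma> n (acc p row (Suc r))) - ?c (Suc r)
      = int (word_val \<sigma> n (acc p row r)) - ?c r + (int (word_val \<sigma> n (row (Suc r))) + 1)] (mod (2 ^ n + 1))"
    (is "[_ = ?b] (mod _)")
    unfolding eq by (simp only: cong_def mod_mult_self2)
  also have "[?b = (\<Sum>s\<le>r. int (word_val \<sigma> n (row s))) + int r - of_bool (signal_val \<sigma> t)
      + (int (word_val \<sigma> n (row (Suc r))) + 1)] (mod (2 ^ n + 1))"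
    using Suc by (intro cong_add cong_refl) simp
  finally show ?case by (simp add: algebra_simps)
qed

section \<open>Correctness of the residue computations\<close>

lemma input_word_val:
  assumes "encodes l \<sigma> z u" "bit_number l u" "l \<le> n"
  shows "word_val \<sigma> n (input_word l z) = u"
proof -
  have l: "u < 2 ^ l" using assms(2) by (simp add: bit_number_def)
  then have "u < 2 ^ n" using assms(3) by (meson less_le_trans one_le_numeral power_increasing)
  moreover have "\<not> bit u j" if "l \<le> j" for j
    using l that by (metis bit_take_bit_iff leD take_bit_nat_eq_self)
  ultimately show ?thesis
    using assms(1) by (simp add: word_val_eq_iff input_word_def encodes_def)
qed

lemma word_val_blocks:
  "(\<Sum>r<R. 2 ^ (m * r) * word_val \<sigma> m (\<lambda>j. A (m * r + j))) = word_val \<sigma> (m * R) A"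
proof (induction R)
  case (Suc R)
  then show ?case using word_val_split[of \<sigma> "m * R" m A] by (simp add: add.commute)
qed (simp add: word_val_def)

lemma fold_correct:
  assumes "ext_sat \<sigma> (fold_formula l i n z)" "l \<ge> 1" "n \<ge> 1" "encodes l \<sigma> z u" "bit_number l u"
  shows "[word_val \<sigma> (2 * n) (fold_word l i n z) = u] (mod (2 ^ (2 * n) - 1))"
proof -
  define R where "R = fold_count l n"
  have R: "R \<ge> 1" using fold_count_pos assms(2,3) by (simp add: R_def)
  let ?w = "\<lambda>r. word_val \<sigma> (2 * n) (fold_rows l n z r)"
  let ?M = "2 ^ (2 * n) - 1 :: nat"
  have "[word_val \<sigma> (2 * n) (fold_word l i n z) = (\<Sum>r\<le>R - 1. ?w r)] (mod ?M)"
    using sum_minus_correct[OF assms(1)[unfolded fold_formula_def], of "R - 1"] R assms(3)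
    by (simp add: fold_word_def R_def)
  \<comment> \<open>The factor \<open>1 ^ r\<close> is inserted so that it can be exchanged, summand
    by summand, for the true weight of block \<open>r\<close>.\<close>
  also have "(\<Sum>r\<le>R - 1. ?w r) = (\<Sum>r<R. 1 ^ r * ?w r)"
    using R by (cases R) (simp_all add: lessThan_Suc_atMost)
  also have "[\<dots> = (\<Sum>r<R. (2 ^ (2 * n)) ^ r * ?w r)] (mod ?M)"
    by (intro cong_sum cong_mult cong_pow cong_refl cong_sym[OF pow_cong_1])
  also have "(\<Sum>r<R. (2 ^ (2 * n)) ^ r * ?w r) = word_val \<sigma> (2 * n * R) (input_word l z)"
    unfolding word_val_blocks[of "2 * n" _ "input_word l z", symmetric] fold_rows_def[abs_def]
    by (simp add: power_mult)
  also have "\<dots> = u"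
  proof (rule input_word_val[OF assms(4,5)])
    \<comment> \<open>\<open>fold_count\<close> rounds \<open>l / (2 * n)\<close> up, so the blocks
      cover all \<open>l\<close> bits.\<close>
    have "l + 2 * n - 1 < 2 * n * R + 2 * n"
      using assms(3) dividend_less_times_div[of "2 * n" "l + 2 * n - 1"]
      by (simp add: R_def fold_count_def algebra_simps)
    then show "l \<le> 2 * n * R" by linarith
  qed
  finally show ?thesis .
qed

text \<open>The reason for folding modulo \<open>2 ^ (2 * n) - 1\<close>: the folded operand,
  computed once, can be reduced further modulo both factors.\<close>

lemma pow_double: "(2 ^ (2 * n) - 1 :: nat) = (2 ^ n - 1) * (2 ^ n + 1)"
  by (simp add: mult_2 power_add diff_mult_distrib add_mult_distrib2)

lemma minus_correct:
  assumes "ext_sat \<sigma> (minus_formula l i n z)" "n \<ge> 1"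
    and "[word_val \<sigma> (2 * n) (fold_word l i n z) = u] (mod (2 ^ (2 * n) - 1))"
  shows "[word_val \<sigma> n (minus_word i z) = u] (mod (2 ^ n - 1))"
proof -
  let ?f = "fold_word l i n z"
  have "minus_word i z = acc (Minus i z) (\<lambda>r j. ?f (r * n + j)) 1"
    by (simp add: minus_word_def[abs_def] acc_def)
  then have "[word_val \<sigma> n (minus_word i z) = word_val \<sigma> n ?f + word_val \<sigma> n (\<lambda>j. ?f (n + j))] (mod (2 ^ n - 1))"
    (is "[_ = ?b] (mod _)")
    using sum_minus_correct[OF assms(1)[unfolded minus_formula_def] assms(2), of 1] by simp
  also have "[?b = word_val \<sigma> n ?f + 2 ^ n * word_val \<sigma> n (\<lambda>j. ?f (n + j))] (mod (2 ^ n - 1))"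
    using cong_mult[OF cong_sym[OF pow_cong_1[of n]] cong_refl[of "word_val \<sigma> n (\<lambda>j. ?f (n + j))"]]
    by (intro cong_add cong_refl) simp
  also have "word_val \<sigma> n ?f + 2 ^ n * word_val \<sigma> n (\<lambda>j. ?f (n + j)) = word_val \<sigma> (2 * n) ?f"
    using word_val_split[of \<sigma> n n ?f] by (simp add: mult_2)
  also have "[\<dots> = u] (mod (2 ^ n - 1))"
    using assms(3) unfolding pow_double by (rule cong_modulus_mult_nat)
  finally show ?thesis .
qed

lemma plus_correct:
  assumes "ext_sat \<sigma> (plus_formula l i n z)" "n \<ge> 1"
    and "[word_val \<sigma> (2 * n) (fold_word l i n z) = u] (mod (2 ^ (2 * n) - 1))"
  shows "[int (word_val \<sigma> n (plus_word i z)) + of_bool (signal_val \<sigma> (plus_extra i n z)) = int u] (mod (2 ^ n + 1))"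
proof -
  let ?f = "fold_word l i n z"
  let ?row = "\<lambda>r j. if r = 0 then ?f j else inv_signal (?f (n + j))"
  let ?a = "int (word_val \<sigma> n ?f)" and ?b = "int (word_val \<sigma> n (\<lambda>j. ?f (n + j)))"
  let ?t = "of_bool (\<sigma> (Carry (Plus i z) 1 n)) :: int"
  have "plus_word i z = acc (Plus i z) ?row 1"
    by (simp add: plus_word_def[abs_def] acc_def)
  then have "[int (word_val \<sigma> n (plus_word i z)) - ?t
      = ?a + int (word_val \<sigma> n (\<lambda>j. inv_signal (?f (n + j)))) + 1] (mod (2 ^ n + 1))"
    using sum_plus_correct[OF assms(1)[unfolded plus_formula_def] assms(2), of 1] by (simp add: carry_plus_def)
  moreover have "int (word_val \<sigma> n (\<lambda>j. inv_signal (?f (n + j)))) = 2 ^ n - 1 - ?b"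
    using arg_cong[OF word_val_complement[of n \<sigma> "\<lambda>j. inv_signal (?f (n + j))" "\<lambda>j. ?f (n + j)"], of int]
    by simp
  \<comment> \<open>Adding 1 turns the subtracted carry \<open>t\<close> into the extra bit
    \<open>1 - t\<close>.\<close>
  ultimately have "[int (word_val \<sigma> n (plus_word i z)) - ?t + 1 = ?a + (2 ^ n - 1 - ?b) + 1 + 1] (mod (2 ^ n + 1))"
    by (intro cong_add cong_refl) simp
  \<comment> \<open>The left side is \<open>?a - ?b\<close> plus the modulus, and
    \<open>- ?b\<close> is congruent to \<open>2 ^ n * ?b\<close>, which restores the value of the
    whole folded word.\<close>
  also have "?a + (2 ^ n - 1 - ?b) + 1 + 1 = ?a + 2 ^ n * ?b + (2 ^ n + 1) * (1 - ?b)"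
    by (simp add: algebra_simps)
  also have "[\<dots> = ?a + 2 ^ n * ?b] (mod (2 ^ n + 1))"
    by (simp only: cong_def mod_mult_self2)
  also have "?a + 2 ^ n * ?b = int (word_val \<sigma> (2 * n) ?f)"
    using word_val_split[of \<sigma> n n ?f] by (simp add: mult_2)
  also have "[\<dots> = int u] (mod (2 ^ n + 1))"
  proof -
    have "[word_val \<sigma> (2 * n) ?f = u] (mod (2 ^ n + 1))"
      using assms(3) unfolding pow_double by (subst (asm) mult.commute) (rule cong_modulus_mult_nat)
    from this[folded cong_int_iff] show ?thesis by (simp add: add.commute)
  qed
  finally show ?thesis by (simp add: plus_extra_def of_bool_not_iff algebra_simps)
qed

section \<open>Correctness of the three multipliers\<close>

lemma and_rows_sat:
  assumes "ext_sat \<sigma> (concat (map (\<lambda>r. map (\<lambda>j. and_gate (And p r j) (a r j) (b r j)) (xs r)) [0..<m]))"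
    and "r < m" "j \<in> set (xs r)"
  shows "\<sigma> (And p r j) = (signal_val \<sigma> (a r j) \<and> signal_val \<sigma> (b r j))"
proof -
  have "ext_sat \<sigma> (map (\<lambda>j. and_gate (And p r j) (a r j) (b r j)) (xs r))"
    using assms(1,2) by (simp add: ext_sat_concat)
  then show ?thesis using assms(3) by (simp add: ext_sat_def and_gate_def)
qed

lemma word_val_mult: "(\<Sum>r<n. of_bool (signal_val \<sigma> (A r)) * (2 ^ r * y)) = word_val \<sigma> n A * (y :: nat)"
  by (simp add: word_val_def sum_distrib_right mult.assoc)

text \<open>Multiplication by \<open>2 ^ r\<close> is rotation by \<open>r\<close>, so row
  \<open>r\<close> is the rotated second operand, masked by bit \<open>r\<close> of the first:
  schoolbook multiplication on a cycle.\<close>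

lemma mul_minus_correct:
  assumes F: "ext_sat \<sigma> (mul_minus_gates i n)" and "n \<ge> 1"
    and "[word_val \<sigma> n (minus_word i U) = u] (mod (2 ^ n - 1))"
    and "[word_val \<sigma> n (minus_word i V) = v] (mod (2 ^ n - 1))"
  shows "[word_val \<sigma> n (acc (MulMinus i) (\<lambda>r j. Wire (And (MulMinus i) r j)) (n - 1)) = u * v] (mod (2 ^ n - 1))"
proof -
  let ?row = "\<lambda>r j. Wire (And (MulMinus i) r j)"
  let ?B = "minus_word i V"
  let ?a = "\<lambda>r. signal_val \<sigma> (minus_word i U r)"
  let ?M = "2 ^ n - 1 :: nat"
  note F' = F[unfolded mul_minus_gates_def ext_sat_append, THEN conjunct1]
  have row: "[word_val \<sigma> n (?row r) = of_bool (?a r) * (2 ^ r * word_val \<sigma> n ?B)] (mod ?M)" if r: "r < n" for r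
  proof -
    let ?L = "word_val \<sigma> (n - r) ?B" and ?H = "word_val \<sigma> r (\<lambda>j. ?B (n - r + j))"
    have "word_val \<sigma> n (?row r) = of_bool (?a r) * word_val \<sigma> n (\<lambda>j. ?B ((j + n - r) mod n))"
    proof (rule word_val_and)
      fix j assume "j < n"
      then show "signal_val \<sigma> (?row r j) = (?a r \<and> signal_val \<sigma> (?B ((j + n - r) mod n)))"
        using and_rows_sat[OF F' r, of j] by simp
    qed
    \<comment> \<open>Rotation puts the top \<open>r\<close> bits \<open>?H\<close> into the low
      positions; below they regain their weight \<open>2 ^ n\<close> modulo
      \<open>?M\<close>.\<close>
    also have "word_val \<sigma> n (\<lambda>j. ?B ((j + n - r) mod n)) = ?H + 2 ^ r * ?L"
    proof -
      have "word_val \<sigma> (r + (n - r)) (\<lambda>j. ?B ((j + n - r) mod n)) = ?H + 2 ^ r * ?L"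
        unfolding word_val_split using r
        by (intro arg_cong2[where f = "(+)"] arg_cong2[where f = "(*)"] refl word_val_cong)
          (simp_all add: add.commute)
      then show ?thesis using r by simp
    qed
    also have "[of_bool (?a r) * (?H + 2 ^ r * ?L) = of_bool (?a r) * (2 ^ n * ?H + 2 ^ r * ?L)] (mod ?M)"
      using cong_mult[OF cong_sym[OF pow_cong_1[of n]] cong_refl[of ?H]]
      by (intro cong_mult cong_add cong_refl) simp
    also have "2 ^ n * ?H + 2 ^ r * ?L = 2 ^ r * word_val \<sigma> n ?B"
      using word_val_rotate[OF r, of \<sigma> ?B] r by (simp add: algebra_simps flip: power_add)
    finally show ?thesis .
  qed
  have "[word_val \<sigma> n (acc (MulMinus i) ?row (n - 1)) = (\<Sum>r\<le>n - 1. word_val \<sigma> n (?row r))] (mod ?M)"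
    using F assms(2) by (intro sum_minus_correct) (auto simp: mul_minus_gates_def ext_sat_append)
  also have "{..n - 1} = {..<n}" using assms(2) by auto
  also have "[(\<Sum>r<n. word_val \<sigma> n (?row r)) = (\<Sum>r<n. of_bool (?a r) * (2 ^ r * word_val \<sigma> n ?B))] (mod ?M)"
    by (intro cong_sum row) simp
  also have "(\<Sum>r<n. of_bool (?a r) * (2 ^ r * word_val \<sigma> n ?B)) = word_val \<sigma> n (minus_word i U) * word_val \<sigma> n ?B"
    by (rule word_val_mult)
  also have "[\<dots> = u * v] (mod ?M)" using assms(3,4) by (rule cong_mult)
  finally show ?thesis .
qed

text \<open>A bit wrapping past \<open>2 ^ n\<close> should count negatively. Inverting the wrapped
  bits of row \<open>r\<close> replaces \<open>- H\<close> by \<open>2 ^ r - 1 - H\<close>, which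
  avoids subtraction at the price of a known excess.\<close>

lemma mul_plus_correct:
  assumes F: "ext_sat \<sigma> (mul_plus_gates i n)" and "n \<ge> 1"
    and "[int (word_val \<sigma> n (plus_word i U)) + of_bool (signal_val \<sigma> (plus_extra i n U)) = int u] (mod (2 ^ n + 1))"
    and "[int (word_val \<sigma> n (plus_word i V)) + of_bool (signal_val \<sigma> (plus_extra i n V)) = int v] (mod (2 ^ n + 1))"
  shows "[int (word_val \<sigma> n (acc (MulPlus i) (plus_row i n) (n + 1)))
      - of_bool (signal_val \<sigma> (carry_plus (MulPlus i) n (Inv (And (MulPlus i) (n + 2) 0)) (n + 1)))
    = int (u * v) + 2 ^ n - 1] (mod (2 ^ n + 1))"
proof -
  let ?row = "plus_row i n"
  let ?A = "plus_word i U" and ?B = "plus_word i V"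
  let ?a = "\<lambda>r. signal_val \<sigma> (?A r)"
  let ?c = "signal_val \<sigma> (plus_extra i n U)" and ?d = "signal_val \<sigma> (plus_extra i n V)"
  let ?M = "2 ^ n + 1 :: int"
  let ?w = "\<lambda>r. int (word_val \<sigma> n (?row r))"
  let ?X = "int (word_val \<sigma> n ?A)" and ?Y = "int (word_val \<sigma> n ?B)"
  note F' = F[unfolded mul_plus_gates_def ext_sat_append]
  note F1 = F'[THEN conjunct1, THEN conjunct1, THEN conjunct1, THEN conjunct1]
  have row: "[?w r = of_bool (?a r) * (2 ^ r * ?Y) + (2 ^ r - 1)] (mod ?M)" if r: "r < n" for r
  proof -
    let ?L = "word_val \<sigma> (n - r) ?B" and ?H = "word_val \<sigma> r (\<lambda>j. ?B (n - r + j))"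
    have And: "\<sigma> (And (MulPlus i) r j) = (?a r \<and> signal_val \<sigma> (?B ((j + n - r) mod n)))" if "j < n" for j
      using and_rows_sat[OF F1 r, of j] that by simp
    have "word_val \<sigma> r (\<lambda>j. Wire (And (MulPlus i) r j)) = of_bool (?a r) * ?H"
      using r by (intro word_val_and) (simp add: And add.commute)
    moreover have "word_val \<sigma> r (\<lambda>j. Wire (And (MulPlus i) r j)) + word_val \<sigma> r (?row r) + 1 = 2 ^ r"
      using r by (intro word_val_complement) (simp add: plus_row_def)
    ultimately have "of_bool (?a r) * ?H + word_val \<sigma> r (?row r) + 1 = 2 ^ r" by (simp only:)
    from arg_cong[OF this, of int]
    have lower: "int (word_val \<sigma> r (?row r)) = 2 ^ r - 1 - of_bool (?a r) * int ?H"
      unfolding of_nat_add of_nat_mult of_nat_of_bool by simp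
    have upper: "word_val \<sigma> (n - r) (\<lambda>j. ?row r (r + j)) = of_bool (?a r) * ?L"
      using r by (intro word_val_and) (simp add: And plus_row_def)
    have "?w r = int (word_val \<sigma> r (?row r)) + 2 ^ r * int (word_val \<sigma> (n - r) (\<lambda>j. ?row r (r + j)))"
      using word_val_split[of \<sigma> r "n - r" "?row r"] r by simp
    \<comment> \<open>The wrapped part counts as \<open>- H\<close>, which is
      \<open>2 ^ n * H\<close> minus the modulus times \<open>H\<close>.\<close>
    also have "\<dots> = of_bool (?a r) * (2 ^ n * int ?H + 2 ^ r * int ?L) + (2 ^ r - 1)
        + ?M * (- (of_bool (?a r) * int ?H))"
      unfolding lower upper by (simp add: algebra_simps)
    also have "2 ^ n * int ?H + 2 ^ r * int ?L = 2 ^ r * ?Y"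
      using word_val_rotate[OF r, of \<sigma> ?B] r by (simp add: algebra_simps flip: power_add)
    also have "[of_bool (?a r) * (2 ^ r * ?Y) + (2 ^ r - 1) + ?M * (- (of_bool (?a r) * int ?H))
        = of_bool (?a r) * (2 ^ r * ?Y) + (2 ^ r - 1)] (mod ?M)"
      by (simp only: cong_def mod_mult_self2)
    finally show ?thesis .
  qed
  have row_n: "?w n = of_bool ?d * ?X"
  proof -
    have "word_val \<sigma> n (?row n) = of_bool ?d * word_val \<sigma> n ?A"
      using F' by (intro word_val_and) (auto simp: plus_row_def ext_sat_def and_gate_def)
    then show ?thesis by simp
  qed
  have row_Suc: "?w (n + 1) = of_bool ?c * ?Y"
  proof -
    have "word_val \<sigma> n (?row (n + 1)) = of_bool ?c * word_val \<sigma> n ?B"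
      using F' by (intro word_val_and) (auto simp: plus_row_def ext_sat_def and_gate_def)
    then show ?thesis by simp
  qed
  have t: "of_bool (signal_val \<sigma> (Inv (And (MulPlus i) (n + 2) 0))) = 1 - of_bool ?c * (of_bool ?d :: int)"
    using F' by (auto simp: ext_sat_def and_gate_def)
  \<comment> \<open>The \<open>- n\<close> is compensated later: the \<open>n + 1\<close> additions
    contribute \<open>n + 1\<close>, and the initial carry \<open>c * d - 1\<close>, leaving the
    shift \<open>2 ^ n - 1\<close> and the term \<open>c * d\<close>.\<close>
  have "(\<Sum>r<n. 2 ^ r - 1 :: int) = 2 ^ n - 1 - int n"
    by (induction n) auto
  then have excess: "(\<Sum>r<n. of_bool (?a r) * (2 ^ r * ?Y) + (2 ^ r - 1)) = ?X * ?Y + (2 ^ n - 1 - int n)"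
    using arg_cong[OF word_val_mult[where y = "word_val \<sigma> n ?B" and A = ?A and \<sigma> = \<sigma> and n = n], of int]
    by (simp add: sum.distrib)
  have "[int (word_val \<sigma> n (acc (MulPlus i) ?row (n + 1)))
      - of_bool (signal_val \<sigma> (carry_plus (MulPlus i) n (Inv (And (MulPlus i) (n + 2) 0)) (n + 1)))
    = (\<Sum>s\<le>n + 1. ?w s) + int (n + 1) - of_bool (signal_val \<sigma> (Inv (And (MulPlus i) (n + 2) 0)))] (mod ?M)"
    using F' assms(2) by (intro sum_plus_correct) auto
  also have "(\<Sum>s\<le>n + 1. ?w s) + int (n + 1) - of_bool (signal_val \<sigma> (Inv (And (MulPlus i) (n + 2) 0)))
    = (\<Sum>s<n. ?w s) + (of_bool ?d * ?X + of_bool ?c * ?Y + of_bool ?c * of_bool ?d + int n)"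
    unfolding t by (simp add: row_n row_Suc[simplified] flip: lessThan_Suc_atMost)
  also have "[\<dots> = (\<Sum>r<n. of_bool (?a r) * (2 ^ r * ?Y) + (2 ^ r - 1))
      + (of_bool ?d * ?X + of_bool ?c * ?Y + of_bool ?c * of_bool ?d + int n)] (mod ?M)"
    (is "[_ = ?b] (mod _)")
    by (intro cong_add cong_sum cong_refl row) simp
  \<comment> \<open>The two extra rows and the initial carry are exactly the cross terms of this
    product.\<close>
  also have "?b = (?X + of_bool ?c) * (?Y + of_bool ?d) + (2 ^ n - 1)"
    unfolding excess by (simp add: algebra_simps)
  also have "[\<dots> = int u * int v + (2 ^ n - 1)] (mod ?M)"
    using assms(3,4) by (intro cong_add cong_mult cong_refl)
  finally show ?thesis by (simp only: of_nat_mult add_diff_eq)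
qed

text \<open>Bits of weight \<open>2 ^ n\<close> and above are never formed, and row \<open>r\<close>
  is zero below position \<open>r\<close>. So adder \<open>r\<close> handles the positions from
  \<open>r\<close> on, and the accumulated bits below are already final.\<close>

lemma mul_pow_correct:
  assumes F: "ext_sat \<sigma> (mul_pow_gates l n)" and "n \<ge> 1"
  shows "[word_val \<sigma> n (acc_pow (n - 1)) = word_val \<sigma> n (input_word l U) * word_val \<sigma> n (input_word l V)] (mod 2 ^ n)"
proof -
  let ?A = "input_word l U" and ?B = "input_word l V"
  let ?a = "\<lambda>r. of_bool (signal_val \<sigma> (?A r)) :: nat"
  let ?Y = "word_val \<sigma> n ?B"
  note F' = F[unfolded mul_pow_gates_def ext_sat_append]
  have And: "\<sigma> (And MulPow r j) = (signal_val \<sigma> (?A r) \<and> signal_val \<sigma> (?B (j - r)))" if "r \<le> j" "j < n" for r j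
    using and_rows_sat[OF F'[THEN conjunct1], of r j] that by simp
  have row: "[(\<Sum>j=r..<n. of_bool (\<sigma> (And MulPow r j)) * 2 ^ j) = ?a r * (2 ^ r * ?Y)] (mod 2 ^ n)" if "r < n" for r
  proof -
    have "(\<Sum>j=r..<n. of_bool (\<sigma> (And MulPow r j)) * 2 ^ j)
        = (\<Sum>j<n - r. of_bool (\<sigma> (And MulPow r (r + j))) * 2 ^ (r + j) :: nat)"
      using sum.shift_bounds_nat_ivl[of "\<lambda>j. of_bool (\<sigma> (And MulPow r j)) * 2 ^ j :: nat" 0 r "n - r"] that
      by (simp add: atLeast0LessThan add.commute)
    also have "\<dots> = (\<Sum>j<n - r. ?a r * (2 ^ r * (of_bool (signal_val \<sigma> (?B j)) * 2 ^ j)))"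
      using that by (intro sum.cong) (auto simp: And power_add)
    also have "\<dots> = ?a r * (2 ^ r * word_val \<sigma> (n - r) ?B)"
      by (simp only: word_val_def sum_distrib_left)
    finally have sum: "(\<Sum>j=r..<n. of_bool (\<sigma> (And MulPow r j)) * 2 ^ j)
        = ?a r * (2 ^ r * word_val \<sigma> (n - r) ?B)" .
    \<comment> \<open>The second summand is the part of the partial product that the circuit omits;
      it is a multiple of \<open>2 ^ n\<close>.\<close>
    have "?a r * (2 ^ r * ?Y) = ?a r * (2 ^ r * word_val \<sigma> (n - r) ?B)
        + 2 ^ n * (?a r * word_val \<sigma> r (\<lambda>j. ?B (n - r + j)))"
      using word_val_rotate[OF that, of \<sigma> ?B] that by (simp add: algebra_simps flip: power_add)
    then show ?thesis unfolding sum by (simp add: cong_def)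
  qed
  have "[word_val \<sigma> n (acc_pow r) = (\<Sum>s\<le>r. ?a s * (2 ^ s * ?Y))] (mod 2 ^ n)" if "r < n" for r
    using that
  proof (induction r)
    case 0
    have "word_val \<sigma> n (acc_pow 0) = (\<Sum>j=0..<n. of_bool (\<sigma> (And MulPow 0 j)) * 2 ^ j)"
      by (simp add: word_val_def acc_pow_def atLeast0LessThan)
    then show ?case using row[OF 0] by (simp only: atMost_0 sum.insert[OF finite.emptyI] sum.empty
      empty_iff not_False_eq_True add_0_right)
  next
    case (Suc r)
    let ?f = "\<lambda>r j. of_bool (signal_val \<sigma> (acc_pow r j)) * 2 ^ j :: nat"
    \<comment> \<open>The cut is at the first position that the adder of row \<open>Suc r\<close>
      touches; below it \<open>acc_pow r\<close> and \<open>acc_pow (Suc r)\<close>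
      coincide.\<close>
    have split: "word_val \<sigma> n (acc_pow s) = (\<Sum>j<Suc r. ?f s j) + (\<Sum>j=Suc r..<n. ?f s j)" for s
      using sum.atLeastLessThan_concat[of 0 "Suc r" n "?f s"] Suc.prems
      by (simp add: word_val_def atLeast0LessThan del: sum.lessThan_Suc)
    have low: "(\<Sum>j<Suc r. ?f (Suc r) j) = (\<Sum>j<Suc r. ?f r j)"
      by (intro sum.cong refl) (simp add: acc_pow_def min_absorb2 less_Suc_eq_le)
    have "(\<Sum>j=Suc r..<n. ?f (Suc r) j) = (\<Sum>j=Suc r..<n. of_bool (\<sigma> (Sum MulPow (Suc r) j)) * 2 ^ j)"
      by (intro sum.cong) (auto simp: acc_pow_def min_def)
    also have "[\<dots> = (\<Sum>j=Suc r..<n. ?f r j) + (\<Sum>j=Suc r..<n. of_bool (signal_val \<sigma> (Wire (And MulPow (Suc r) j))) * 2 ^ j)]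
        (mod 2 ^ n)" (is "[_ = ?b] (mod _)")
    proof (rule adder_mod)
      show "ext_sat \<sigma> (adder MulPow (Suc r) (Suc r) n (n - 1) (acc_pow r) (\<lambda>j. Wire (And MulPow (Suc r) j)) (Const False))"
        using F' Suc.prems by (force simp: ext_sat_concat)
    qed fact
    also have "[?b = (\<Sum>j=Suc r..<n. ?f r j) + ?a (Suc r) * (2 ^ Suc r * ?Y)] (mod 2 ^ n)"
      using row[OF Suc.prems] by (intro cong_add cong_refl) simp
    finally have "[word_val \<sigma> n (acc_pow (Suc r)) = word_val \<sigma> n (acc_pow r) + ?a (Suc r) * (2 ^ Suc r * ?Y)] (mod 2 ^ n)"
      (is "[_ = ?c] (mod _)")
      unfolding split low add.assoc by (intro cong_add cong_refl)
    also have "[?c = (\<Sum>s\<le>r. ?a s * (2 ^ s * ?Y)) + ?a (Suc r) * (2 ^ Suc r * ?Y)] (mod 2 ^ n)"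
      using Suc by (intro cong_add cong_refl) simp
    finally show ?case by simp
  qed
  from this[of "n - 1"] have "[word_val \<sigma> n (acc_pow (n - 1)) = (\<Sum>s\<le>n - 1. ?a s * (2 ^ s * ?Y))] (mod 2 ^ n)"
    using assms(2) by simp
  also have "{..n - 1} = {..<n}" using assms(2) by auto
  also have "(\<Sum>s<n. ?a s * (2 ^ s * ?Y)) = word_val \<sigma> n ?A * ?Y" by (rule word_val_mult)
  finally show ?thesis .
qed

section \<open>Correctness of the comparisons\<close>

text \<open>An \<open>n\<close>-bit word is determined by its residue except for residue 0, which
  all zeros and all ones share. Equality of cyclically neighbouring bits says that the word is
  constant, so it admits exactly these two.\<close>

lemma compare_minus_sat:
  assumes "n \<ge> 1"
  shows "ext_sat \<sigma> (compare_minus n x s) \<longleftrightarrow> [word_val \<sigma> n s = x] (mod (2 ^ n - 1))"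
proof -
  define M X S where "M = (2 ^ n - 1 :: nat)" and "X = x mod M" and "S = word_val \<sigma> n s"
  have S: "S \<le> M" using word_val_less[of \<sigma> n s] by (simp add: S_def M_def)
  have "2 \<le> (2 :: nat) ^ n" using assms self_le_power[of 2 n] by simp
  then have M: "M \<ge> 1" "M < 2 ^ n" unfolding M_def by linarith+
  have range: "(\<forall>j\<in>set [0..<n]. P j) \<longleftrightarrow> (\<forall>j<n. P j)" for P by auto
  have cong: "[S = x] (mod M) \<longleftrightarrow> S mod M = X" by (simp add: cong_def X_def)
  show ?thesis
  proof (cases "X = 0")
    case True
    have "ext_sat \<sigma> (compare_minus n x s) \<longleftrightarrow> (\<forall>j<n. signal_val \<sigma> (s j) = signal_val \<sigma> (s (Suc j mod n)))"
      unfolding compare_minus_def Let_def M_def[symmetric] X_def[symmetric] ext_sat_def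
      using True by (simp only: set_map ball_simps prod.case range if_True if_False simp_thms)
    also have "\<dots> \<longleftrightarrow> (\<forall>j<n. signal_val \<sigma> (s j) = signal_val \<sigma> (s 0))"
    proof
      assume *: "\<forall>j<n. signal_val \<sigma> (s j) = signal_val \<sigma> (s (Suc j mod n))"
      have "signal_val \<sigma> (s j) = signal_val \<sigma> (s 0)" if "j < n" for j
        using that
      proof (induction j)
        case (Suc j)
        then show ?case using *[rule_format, of j] by simp
      qed simp
      then show "\<forall>j<n. signal_val \<sigma> (s j) = signal_val \<sigma> (s 0)" by blast
    next
      assume *: "\<forall>j<n. signal_val \<sigma> (s j) = signal_val \<sigma> (s 0)"
      show "\<forall>j<n. signal_val \<sigma> (s j) = signal_val \<sigma> (s (Suc j mod n))"
      proof (intro allI impI)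
        fix j assume "j < n"
        then have "signal_val \<sigma> (s j) = signal_val \<sigma> (s 0)" using * by blast
        also have "\<dots> = signal_val \<sigma> (s (Suc j mod n))"
          using *[rule_format, of "Suc j mod n"] assms by (simp only: mod_less_divisor less_le_trans[OF zero_less_one])
        finally show "signal_val \<sigma> (s j) = signal_val \<sigma> (s (Suc j mod n))" .
      qed
    qed
    also have "\<dots> \<longleftrightarrow> S = 0 \<or> S = M"
    proof -
      have "S = 0 \<longleftrightarrow> (\<forall>j<n. \<not> signal_val \<sigma> (s j))" unfolding S_def by (subst word_val_eq_iff) auto
      moreover have bitM: "bit M j \<longleftrightarrow> j < n" for j
        unfolding M_def mask_eq_exp_minus_1[symmetric] bit_mask_iff by simp
      moreover have "S = M \<longleftrightarrow> (\<forall>j<n. signal_val \<sigma> (s j))"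
        unfolding S_def using M(2) bitM by (subst word_val_eq_iff) auto
      ultimately show ?thesis using assms by (metis less_le_trans zero_less_one)
    qed
    also have "\<dots> \<longleftrightarrow> S mod M = X"
      using S M(1) True by (auto simp: order_le_less)
    finally show ?thesis using cong by (simp add: S_def M_def)
  next
    case False
    have XM: "X < M" using M by (simp add: X_def)
    have "ext_sat \<sigma> (compare_minus n x s) \<longleftrightarrow> (\<forall>j<n. signal_val \<sigma> (s j) = bit X j)"
      unfolding compare_minus_def Let_def M_def[symmetric] X_def[symmetric] ext_sat_def
      using False by (simp only: set_map ball_simps prod.case range if_True if_False simp_thms)
    also have "\<dots> \<longleftrightarrow> S = X"
      unfolding S_def using M(2) XM by (subst word_val_eq_iff) auto
    also have "\<dots> \<longleftrightarrow> S mod M = X"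
      using S False XM by (auto simp: order_le_less)
    finally show ?thesis using cong by (simp add: S_def M_def)
  qed
qed

text \<open>For fixed \<open>t\<close> the value \<open>s - t\<close> runs through
  \<open>2 ^ n\<close> consecutive integers, one fewer than the modulus, so each other residue has
  exactly one word and one residue has none: \<open>2 ^ n\<close> if \<open>t\<close> is 0, and
  \<open>2 ^ n - 1\<close> if \<open>t\<close> is 1.\<close>

lemma compare_plus_sat:
  assumes "n \<ge> 1" "X < 2 ^ n + 1"
  shows "ext_sat \<sigma> (compare_plus n X s t) \<longleftrightarrow>
    [int (word_val \<sigma> n s) - of_bool (signal_val \<sigma> t) = int X] (mod (2 ^ n + 1))"
proof -
  define S where "S = word_val \<sigma> n s"
  have S: "S < 2 ^ n" by (simp add: S_def word_val_less)
  have n: "(\<forall>j<n. P \<and> Q j) \<longleftrightarrow> P \<and> (\<forall>j<n. Q j)" for P Q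
    using assms(1) by (metis less_le_trans zero_less_one)
  show ?thesis
  proof (cases "signal_val \<sigma> t")
    case False
    have "ext_sat \<sigma> (compare_plus n X s t) \<longleftrightarrow> X \<noteq> 2 ^ n \<and> (\<forall>j<n. signal_val \<sigma> (s j) = bit X j)"
      unfolding n[symmetric] using False by (auto simp: compare_plus_def ext_sat_def)
    also have "\<dots> \<longleftrightarrow> S = X"
      using S assms(2) word_val_eq_iff[of X n \<sigma> s] by (auto simp: S_def)
    also have "\<dots> \<longleftrightarrow> [int S = int X] (mod int (2 ^ n + 1))"
      unfolding cong_int_iff using S assms(2) by (simp add: cong_def)
    finally show ?thesis using False by (simp add: S_def add.commute)
  next
    case True
    let ?Y = "(X + 1) mod (2 ^ n + 1)"
    have "ext_sat \<sigma> (compare_plus n X s t) \<longleftrightarrow> X \<noteq> 2 ^ n - 1 \<and> (\<forall>j<n. signal_val \<sigma> (s j) = bit ?Y j)"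
      unfolding n[symmetric] using True by (auto simp: compare_plus_def ext_sat_def)
    also have "\<dots> \<longleftrightarrow> S = ?Y"
    proof (cases "X = 2 ^ n - 1")
      case True
      then have "?Y = 2 ^ n" by simp
      then show ?thesis using True S by simp
    next
      case False
      \<comment> \<open>The reduction in \<open>?Y\<close> matters for \<open>X = 2 ^ n\<close>,
        which represents -1: here \<open>X + 1\<close> wraps to the zero word.\<close>
      then have "?Y < 2 ^ n"
        using assms(2) by (cases "X = 2 ^ n") auto
      then show ?thesis using False word_val_eq_iff[of ?Y n \<sigma> s] by (simp add: S_def)
    qed
    also have "\<dots> \<longleftrightarrow> [int S = int (X + 1)] (mod int (2 ^ n + 1))"
      unfolding cong_int_iff using S by (simp add: cong_def)
    also have "\<dots> \<longleftrightarrow> [int S - 1 = int X] (mod int (2 ^ n + 1))"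
      using cong_add_rcancel[of "int S - 1" 1 "int X" "int (2 ^ n + 1)"]
      by (simp only: diff_add_cancel of_nat_add of_nat_1)
    finally show ?thesis using True by (simp add: S_def add.commute)
  qed
qed

lemma compare_pow_sat: "ext_sat \<sigma> (compare_pow n x) \<longleftrightarrow> [word_val \<sigma> n (acc_pow (n - 1)) = x] (mod 2 ^ n)"
proof -
  have "ext_sat \<sigma> (compare_pow n x) \<longleftrightarrow> (\<forall>j<n. signal_val \<sigma> (acc_pow (n - 1) j) = bit (x mod 2 ^ n) j)"
    by (auto simp: compare_pow_def ext_sat_def bit_take_bit_iff simp flip: take_bit_eq_mod)
  also have "\<dots> \<longleftrightarrow> word_val \<sigma> n (acc_pow (n - 1)) = x mod 2 ^ n"
    by (subst word_val_eq_iff) auto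
  also have "\<dots> \<longleftrightarrow> [word_val \<sigma> n (acc_pow (n - 1)) = x] (mod 2 ^ n)"
    by (simp add: cong_def word_val_less)
  finally show ?thesis .
qed


section \<open>Satisfying assignments\<close>

lemma input_word_cong:
  assumes "encodes l \<sigma> z u" "bit_number l u"
  shows "[word_val \<sigma> n (input_word l z) = u] (mod 2 ^ n)"
proof -
  \<comment> \<open>Reading \<open>n + l\<close> positions, padded with zeros, covers both
    \<open>n < l\<close> and \<open>l \<le> n\<close> without a case distinction.\<close>
  have "u = word_val \<sigma> n (input_word l z) + 2 ^ n * word_val \<sigma> l (\<lambda>j. input_word l z (n + j))"
    using input_word_val[OF assms, of "n + l"] by (simp add: word_val_split)
  then show ?thesis by (metis cong_def mod_mult_self2)
qed

lemma mul_pow_sat: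
  assumes "ext_sat \<sigma> (mul_pow_gates l n)" "n \<ge> 1"
    and "encodes l \<sigma> U u" "encodes l \<sigma> V v" "bit_number l u" "bit_number l v"
  shows "ext_sat \<sigma> (mul_pow_formula l n x) \<longleftrightarrow> [u * v = x] (mod 2 ^ n)"
proof -
  have "[word_val \<sigma> n (acc_pow (n - 1)) = u * v] (mod 2 ^ n)"
    using mul_pow_correct[OF assms(1,2)]
      cong_mult[OF input_word_cong[OF assms(3,5)] input_word_cong[OF assms(4,6)]] by (rule cong_trans)
  then show ?thesis using assms(1) unfolding mul_pow_formula_eq ext_sat_append compare_pow_sat
    by (meson cong_sym cong_trans)
qed

lemma residue_sat:
  assumes F: "ext_sat \<sigma> (residue_gates l i n)" and "l \<ge> 1" "n \<ge> 1"
    and "encodes l \<sigma> U u" "encodes l \<sigma> V v" "bit_number l u" "bit_number l v"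
  shows "ext_sat \<sigma> (mul_minus_formula i n x) \<longleftrightarrow> [u * v = x] (mod (2 ^ n - 1))" (is ?minus)
    and "ext_sat \<sigma> (mul_plus_formula i n x) \<longleftrightarrow> [u * v = x] (mod (2 ^ n + 1))" (is ?plus)
proof -
  note F' = F[unfolded residue_gates_def ext_sat_append]
  have U: "[word_val \<sigma> (2 * n) (fold_word l i n U) = u] (mod (2 ^ (2 * n) - 1))"
    and V: "[word_val \<sigma> (2 * n) (fold_word l i n V) = v] (mod (2 ^ (2 * n) - 1))"
    using F' fold_correct[OF _ assms(2,3,4,6)] fold_correct[OF _ assms(2,3,5,7)] by blast+
  have gates: "ext_sat \<sigma> (mul_minus_gates i n)" "ext_sat \<sigma> (mul_plus_gates i n)"
    using F' by auto
  let ?p = "MulMinus i"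
  have "[word_val \<sigma> n (acc ?p (\<lambda>r j. Wire (And ?p r j)) (n - 1)) = u * v] (mod (2 ^ n - 1))"
    using F' assms(3) by (intro mul_minus_correct minus_correct[OF _ _ U] minus_correct[OF _ _ V]) auto
  then show ?minus using gates assms(3)
    unfolding mul_minus_formula_eq ext_sat_append compare_minus_sat[OF assms(3)]
    by (meson cong_sym cong_trans)
  let ?q = "MulPlus i" and ?M = "2 ^ n + 1 :: nat"
  \<comment> \<open>\<open>x\<close> is shifted by the same \<open>2 ^ n - 1\<close> that the
    multiplier adds to the product; the shift cancels at the end.\<close>
  let ?X = "(x + 2 ^ n - 1) mod ?M"
  let ?c = "signal_val \<sigma> (carry_plus ?q n (Inv (And ?q (n + 2) 0)) (n + 1))"
  have prod: "[int (word_val \<sigma> n (acc ?q (plus_row i n) (n + 1))) - of_bool ?c = int (u * v) + 2 ^ n - 1]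
      (mod (2 ^ n + 1))" (is "[?w = _] (mod _)")
    using F' assms(3) by (intro mul_plus_correct plus_correct[OF _ _ U] plus_correct[OF _ _ V]) auto
  have "?X < 2 ^ n + 1" by (rule mod_less_divisor) simp
  then have "ext_sat \<sigma> (mul_plus_formula i n x) \<longleftrightarrow> [?w = int ?X] (mod (2 ^ n + 1))"
    unfolding mul_plus_formula_eq ext_sat_append using gates(2)
    by (simp only: compare_plus_sat[OF assms(3)] simp_thms)
  also have "\<dots> \<longleftrightarrow> [int (u * v) + 2 ^ n - 1 = int ?X] (mod (2 ^ n + 1))"
    using prod unfolding cong_def by (simp only:)
  also have "int (u * v) + 2 ^ n - 1 = int (u * v + (2 ^ n - 1))"
  proof -
    have "int (2 ^ n - 1) = 2 ^ n - 1" by (simp add: of_nat_diff)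
    then show ?thesis by (simp only: of_nat_add add_diff_eq)
  qed
  also have "[int (u * v + (2 ^ n - 1)) = int ?X] (mod (2 ^ n + 1)) \<longleftrightarrow> [u * v + (2 ^ n - 1) = ?X] (mod ?M)"
    using cong_int_iff[of "u * v + (2 ^ n - 1)" ?X ?M] by (simp only: of_nat_add of_nat_power of_nat_numeral of_nat_1)
  also have "\<dots> \<longleftrightarrow> [u * v + (2 ^ n - 1) = x + (2 ^ n - 1)] (mod ?M)"
    by (simp add: cong_def)
  also have "\<dots> \<longleftrightarrow> [u * v = x] (mod ?M)"
    by (rule cong_add_rcancel_nat)
  finally show ?plus .
qed

lemma factoring_formula_sat:
  assumes F: "ext_sat \<sigma> (gates l k e)" and "l \<ge> 1" and e: "\<forall>i\<le>k. e i \<ge> 1"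
    and "encodes l \<sigma> U u" "encodes l \<sigma> V v" "bit_number l u" "bit_number l v"
  shows "ext_sat \<sigma> (factoring_formula l k e x) \<longleftrightarrow>
    [u * v = x] (mod 2 ^ e 0) \<and>
    (\<forall>i\<in>{1..k}. [u * v = x] (mod (2 ^ e i - 1)) \<and> [u * v = x] (mod (2 ^ e i + 1)))"
proof -
  have pow: "ext_sat \<sigma> (mul_pow_gates l (e 0))"
    and res: "ext_sat \<sigma> (residue_gates l i (e i))" if "i \<in> {1..k}" for i
    using F that by (auto simp: gates_def ext_sat_append ext_sat_concat simp del: upt_Suc)
  let ?f = "\<lambda>i. fold_formula l i (e i) U @ fold_formula l i (e i) V @
       minus_formula l i (e i) U @ minus_formula l i (e i) V @ mul_minus_formula i (e i) x @
       plus_formula l i (e i) U @ plus_formula l i (e i) V @ mul_plus_formula i (e i) x"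
  have "ext_sat \<sigma> (?f i) \<longleftrightarrow> [u * v = x] (mod (2 ^ e i - 1)) \<and> [u * v = x] (mod (2 ^ e i + 1))"
    if i: "i \<in> {1..k}" for i
  proof -
    have "ext_sat \<sigma> (?f i) \<longleftrightarrow> ext_sat \<sigma> (mul_minus_formula i (e i) x) \<and> ext_sat \<sigma> (mul_plus_formula i (e i) x)"
      using res[OF i] unfolding residue_gates_def ext_sat_append by blast
    then show ?thesis using residue_sat[OF res[OF i] assms(2) _ assms(4-7)] e i by simp
  qed
  moreover have "ext_sat \<sigma> (factoring_formula l k e x) \<longleftrightarrow>
      ext_sat \<sigma> (mul_pow_formula l (e 0) x) \<and> (\<forall>i\<in>{1..k}. ext_sat \<sigma> (?f i))"
    unfolding factoring_formula_def ext_sat_append ext_sat_concat set_map set_upt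
      atLeastLessThanSuc_atLeastAtMost ball_simps by blast
  moreover have "ext_sat \<sigma> (mul_pow_gates l (e 0))"
    using F by (simp add: gates_def ext_sat_append)
  then have "ext_sat \<sigma> (mul_pow_formula l (e 0) x) \<longleftrightarrow> [u * v = x] (mod 2 ^ e 0)"
    using e assms(4-7) by (intro mul_pow_sat) auto
  ultimately show ?thesis by simp
qed

text \<open>The distance of \<open>a\<close> and \<open>b\<close> is divisible by every modulus,
  hence by the least common multiple, yet smaller than it. It is taken over the integers because
  subtraction of naturals truncates.\<close>

lemma cong_Lcm_imp_eq:
  fixes a b :: nat
  assumes "\<And>m. m \<in> M \<Longrightarrow> [a = b] (mod m)" "a < Lcm M" "b < Lcm M"
  shows "a = b"
proof -
  have "Lcm M dvd nat \<bar>int a - int b\<bar>"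
    using assms(1) by (intro Lcm_least) (simp add: cong_altdef_nat')
  moreover have "nat \<bar>int a - int b\<bar> < Lcm M"
    using assms(2,3) by linarith
  ultimately have "nat \<bar>int a - int b\<bar> = 0"
    using nat_dvd_not_less by blast
  then show ?thesis by simp
qed

section \<open>Variables and clause sizes\<close>

lemma compare_minus_form: "ext_conjunctive_form 4 (compare_minus n x s)"
proof -
  have "card (signal_vars a \<union> signal_vars b) \<le> 4" for a b
    using card_Un_le[of "signal_vars a" "signal_vars b"] card_signal_vars[of a] card_signal_vars[of b] by linarith
  moreover have "on_vars (signal_vars a \<union> signal_vars b)
      (\<lambda>\<sigma>. if P then signal_val \<sigma> a = signal_val \<sigma> b else signal_val \<sigma> a = Q)" for a b P Q
    unfolding on_vars_def
  proof (intro allI impI)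
    fix \<sigma> \<tau> :: "var assignment"
    assume *: "\<forall>y\<in>signal_vars a \<union> signal_vars b. \<sigma> y = \<tau> y"
    have "signal_val \<sigma> a = signal_val \<tau> a" "signal_val \<sigma> b = signal_val \<tau> b"
      using * by (intro signal_val_cong; simp)+
    then show "(if P then signal_val \<sigma> a = signal_val \<sigma> b else signal_val \<sigma> a = Q) =
      (if P then signal_val \<tau> a = signal_val \<tau> b else signal_val \<tau> a = Q)" by simp
  qed
  ultimately show ?thesis
    unfolding ext_conjunctive_form_def compare_minus_def Let_def set_map ball_simps prod.case
    by (intro ballI conjI finite_UnI finite_signal_vars)
qed

lemma compare_plus_form: "ext_conjunctive_form 4 (compare_plus n X s t)"
proof -
  have "card (signal_vars a \<union> signal_vars b) \<le> 4" for a b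
    using card_Un_le[of "signal_vars a" "signal_vars b"] card_signal_vars[of a] card_signal_vars[of b] by linarith
  moreover have "on_vars (signal_vars a \<union> signal_vars b)
      (\<lambda>\<sigma>. if signal_val \<sigma> b then P \<and> signal_val \<sigma> a = P' else Q \<and> signal_val \<sigma> a = Q')" for a b P P' Q Q'
    unfolding on_vars_def
  proof (intro allI impI)
    fix \<sigma> \<tau> :: "var assignment"
    assume *: "\<forall>y\<in>signal_vars a \<union> signal_vars b. \<sigma> y = \<tau> y"
    have "signal_val \<sigma> a = signal_val \<tau> a" "signal_val \<sigma> b = signal_val \<tau> b"
      using * by (intro signal_val_cong; simp)+
    then show "(if signal_val \<sigma> b then P \<and> signal_val \<sigma> a = P' else Q \<and> signal_val \<sigma> a = Q') =
      (if signal_val \<tau> b then P \<and> signal_val \<tau> a = P' else Q \<and> signal_val \<tau> a = Q')" by simp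
  qed
  ultimately show ?thesis
    unfolding ext_conjunctive_form_def compare_plus_def Let_def set_map ball_simps prod.case
    by (intro ballI conjI finite_UnI finite_signal_vars)
qed

lemma compare_pow_form: "ext_conjunctive_form 4 (compare_pow n x)"
proof -
  have "card (signal_vars a) \<le> 4" for a
    using card_signal_vars[of a] by linarith
  moreover have "on_vars (signal_vars a) (\<lambda>\<sigma>. signal_val \<sigma> a = Q)" for a Q
    unfolding on_vars_def using signal_val_cong by metis
  ultimately show ?thesis
    unfolding ext_conjunctive_form_def compare_pow_def set_map ball_simps prod.case
    by (intro ballI conjI finite_signal_vars)
qed

lemma factoring_formula_form:
  assumes "ext_conjunctive_form 4 (gates l k e)"
  shows "ext_conjunctive_form 4 (factoring_formula l k e x)"
  using assms unfolding factoring_formula_def gates_def residue_gates_def mul_pow_formula_eq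
    mul_minus_formula_eq mul_plus_formula_eq
  by (simp add: ext_conjunctive_form_append ext_conjunctive_form_concat compare_minus_form
    compare_plus_form compare_pow_form)

lemma acc_cells:
  assumes "\<And>r j. r < R \<Longrightarrow> j < n \<Longrightarrow> signal_vars (row r j) \<subseteq> I" "R \<ge> 1" "j < n"
  shows "signal_vars (acc p row (R - 1) j) \<subseteq> I \<union> sum_cells p n R"
  using acc_vars[of R n row I "R - 1" j p] assms by simp

lemma compare_minus_vars:
  assumes "n \<ge> 1"
  shows "ext_vars (compare_minus n x (acc (MulMinus i) (\<lambda>r j. Wire (And (MulMinus i) r j)) (n - 1)))
    \<subseteq> mul_minus_cells i n"
proof -
  let ?s = "acc (MulMinus i) (\<lambda>r j. Wire (And (MulMinus i) r j)) (n - 1)"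
  have "signal_vars (?s j) \<subseteq> mul_minus_cells i n" if "j < n" for j
    unfolding mul_minus_cells_def
  proof (rule acc_cells[OF _ assms that])
    show "signal_vars (Wire (And (MulMinus i) r j)) \<subseteq> (\<Union>r\<in>{0..<n}. And (MulMinus i) r ` set [0..<n])"
      if "r < n" "j < n" for r j
      using UN_I[of r "{0..<n}" "And (MulMinus i) r j"] that by auto
  qed
  moreover have "ext_vars (compare_minus n x ?s) = (\<Union>j\<in>{0..<n}. signal_vars (?s j) \<union> signal_vars (?s (Suc j mod n)))"
    unfolding ext_vars_def compare_minus_def Let_def set_map set_upt image_image UN_simps prod.case by simp
  ultimately show ?thesis using assms by (simp add: UN_subset_iff)
qed

lemma compare_plus_vars:
  assumes "n \<ge> 1"
  shows "ext_vars (compare_plus n X (acc (MulPlus i) (plus_row i n) (n + 1))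
       (carry_plus (MulPlus i) n (Inv (And (MulPlus i) (n + 2) 0)) (n + 1))) \<subseteq> mul_plus_cells i n"
    (is "ext_vars (compare_plus n X ?s ?t) \<subseteq> _")
proof -
  have "signal_vars (?s j) \<subseteq> mul_plus_cells i n" if "j < n" for j
  proof -
    have "signal_vars (acc (MulPlus i) (plus_row i n) (n + 2 - 1) j) \<subseteq> mul_plus_cells i n"
      unfolding mul_plus_cells_def by (rule acc_cells[OF plus_row_vars]) (use that in auto)
    then show ?thesis by simp
  qed
  moreover have "signal_vars ?t \<subseteq> mul_plus_cells i n"
    using Carry_in_cells[of "n + 1" "n + 2" n "MulPlus i"] assms by (simp add: carry_plus_def mul_plus_cells_def)
  moreover have "ext_vars (compare_plus n X ?s ?t) = (\<Union>j\<in>{0..<n}. signal_vars (?s j) \<union> signal_vars ?t)"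
    unfolding ext_vars_def compare_plus_def set_map set_upt image_image UN_simps prod.case by simp
  ultimately show ?thesis by (simp add: UN_subset_iff)
qed

lemma compare_pow_vars:
  "ext_vars (compare_pow n x) \<subseteq> mul_pow_cells n"
proof -
  have "signal_vars (acc_pow (n - 1) j) \<subseteq> mul_pow_cells n" if j: "j < n" for j
  proof (cases "j = 0")
    case True
    have "And MulPow 0 0 \<in> (\<Union>r\<in>{0..<n}. And MulPow r ` set [r..<n])"
      by (rule UN_I[of 0]) (use j in auto)
    then show ?thesis using True by (simp add: acc_pow_def mul_pow_cells_def)
  next
    case False
    then have "Sum MulPow j j \<in> adder_cells MulPow j j n (n - 1)" "j \<in> {1..<n}"
      using j by (auto simp: adder_cells_def)
    then have "Sum MulPow j j \<in> (\<Union>r\<in>{1..<n}. adder_cells MulPow r r n (n - 1))" by (rule UN_I[rotated])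
    moreover have "min (n - 1) j = j" using j by simp
    ultimately show ?thesis using False by (simp add: acc_pow_def mul_pow_cells_def)
  qed
  moreover have "ext_vars (compare_pow n x) = (\<Union>j\<in>{0..<n}. signal_vars (acc_pow (n - 1) j))"
    unfolding ext_vars_def compare_pow_def set_map set_upt image_image UN_simps prod.case by simp
  ultimately show ?thesis by (simp add: UN_subset_iff)
qed

text \<open>Comparisons add clauses but no variables: they read only bits already present in the
  gates.\<close>

lemma factoring_formula_vars:
  assumes "ext_vars (gates l k e) \<subseteq> I \<union> gate_cells l k e" "\<forall>i\<le>k. e i \<ge> 1"
  shows "ext_vars (factoring_formula l k e x) \<subseteq> I \<union> gate_cells l k e"
proof -
  let ?D = "I \<union> gate_cells l k e"
  have pow: "mul_pow_cells (e 0) \<subseteq> ?D" by (auto simp: gate_cells_def)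
  have res: "mul_minus_cells i (e i) \<subseteq> ?D" "mul_plus_cells i (e i) \<subseteq> ?D" if i: "i \<in> {1..<Suc k}" for i
  proof -
    have "residue_cells l i (e i) \<subseteq> gate_cells l k e"
      unfolding gate_cells_def using i by (intro le_supI2 UN_upper)
    moreover have "mul_minus_cells i (e i) \<subseteq> residue_cells l i (e i)" "mul_plus_cells i (e i) \<subseteq> residue_cells l i (e i)"
      unfolding residue_cells_def by blast+
    ultimately show "mul_minus_cells i (e i) \<subseteq> ?D" "mul_plus_cells i (e i) \<subseteq> ?D" by blast+
  qed
  have g: "ext_vars (mul_pow_gates l (e 0)) \<subseteq> ?D \<and>
    (\<forall>i\<in>{1..<Suc k}. ext_vars (residue_gates l i (e i)) \<subseteq> ?D)"
    using assms(1) unfolding gates_def ext_vars_append ext_vars_concat set_map set_upt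
    unfolding image_image Un_subset_iff UN_subset_iff .
  have "ext_vars (mul_pow_formula l (e 0) x) \<subseteq> ?D"
    unfolding mul_pow_formula_eq ext_vars_append using conjunct1[OF g] order_trans[OF compare_pow_vars pow] by (rule Un_least)
  moreover have "ext_vars (fold_formula l i (e i) U @ fold_formula l i (e i) V @
       minus_formula l i (e i) U @ minus_formula l i (e i) V @ mul_minus_formula i (e i) x @
       plus_formula l i (e i) U @ plus_formula l i (e i) V @ mul_plus_formula i (e i) x) \<subseteq> ?D"
    if i: "i \<in> {1..<Suc k}" for i
    using bspec[OF conjunct2[OF g] i] order_trans[OF compare_minus_vars res(1)[OF i]] order_trans[OF compare_plus_vars res(2)[OF i]]
      assms(2) i
    unfolding mul_minus_formula_eq mul_plus_formula_eq residue_gates_def ext_vars_append Un_subset_iff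
    by simp
  ultimately show ?thesis
    unfolding factoring_formula_def ext_vars_append[of "mul_pow_formula l (e 0) x"] ext_vars_concat
      set_map set_upt image_image
    by (intro Un_least UN_least)
qed

section \<open>Occurrence of the input variables\<close>

lemma adder_operand_vars:
  assumes "lo \<le> j" "j < n"
  shows "signal_vars (A j) \<union> signal_vars (B j) \<subseteq> ext_vars (adder p r lo n m A B cin)"
proof -
  let ?c = "if j = lo then cin else Wire (Carry p r j)"
  have "sum_gate (Sum p r j) (A j) (B j) ?c \<in> set (adder p r lo n m A B cin)"
    unfolding adder_def Let_def set_append set_map
    by (rule UnI1, rule image_eqI[of _ _ j]) (use assms in auto)
  then have "fst (sum_gate (Sum p r j) (A j) (B j) ?c) \<subseteq> ext_vars (adder p r lo n m A B cin)"
    unfolding ext_vars_def case_prod_beta by (rule UN_upper)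
  then show ?thesis by (simp add: sum_gate_def)
qed

lemma sum_minus_row_vars:
  assumes "r < R" "2 \<le> R" "j < n"
  shows "signal_vars (row r j) \<subseteq> ext_vars (sum_minus p n row R)"
proof -
  \<comment> \<open>Row 0 has no adder of its own; it enters adder 1 as the accumulator, together
    with row 1.\<close>
  define s where "s = max 1 r"
  have s: "s \<in> {1..<R}" using assms by (auto simp: s_def)
  let ?f = "\<lambda>s. adder p s 0 n n (acc p row (s - 1)) (row s) (Wire (Carry p s n))"
  have "signal_vars (row r j) \<subseteq> signal_vars (acc p row (s - 1) j) \<union> signal_vars (row s j)"
    by (cases "r = 0") (auto simp: s_def acc_def)
  also have "\<dots> \<subseteq> ext_vars (?f s)"
    using assms(3) by (intro adder_operand_vars) auto
  also have "\<dots> \<subseteq> ext_vars (sum_minus p n row R)"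
    unfolding sum_minus_def ext_vars_concat set_map set_upt image_image using s by (intro UN_upper imageI)
  finally show ?thesis .
qed

text \<open>With at least two blocks every input bit is an operand of a folding adder. With a single
  block the folding formula is empty, and the bits go straight into the addition of the two
  halves.\<close>

lemma input_in_residue:
  assumes "j < l" "n \<ge> 1"
  shows "Input z j \<in> ext_vars (fold_formula l i n z) \<union> ext_vars (minus_formula l i n z)"
proof (cases "fold_count l n \<ge> 2")
  case True
  have "l + 2 * n - 1 < 2 * n * fold_count l n + 2 * n"
    using assms(2) dividend_less_times_div[of "2 * n" "l + 2 * n - 1"]
    by (simp add: fold_count_def algebra_simps)
  then have "j < fold_count l n * (2 * n)" using assms(1) by (simp add: mult.commute)
  then have "j div (2 * n) < fold_count l n" by (rule less_mult_imp_div_less)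
  moreover have "j mod (2 * n) < 2 * n" using assms(2) by simp
  ultimately have "signal_vars (fold_rows l n z (j div (2 * n)) (j mod (2 * n))) \<subseteq> ext_vars (fold_formula l i n z)"
    unfolding fold_formula_def using True by (intro sum_minus_row_vars)
  then show ?thesis using assms(1) by (simp add: fold_rows_def input_word_def)
next
  case False
  have "l + 2 * n - 1 < 2 * n * fold_count l n + 2 * n"
    using assms(2) dividend_less_times_div[of "2 * n" "l + 2 * n - 1"]
    by (simp add: fold_count_def algebra_simps)
  moreover have "fold_count l n = 1" using False fold_count_pos[of l n] assms by simp
  ultimately have j: "j < 2 * n" "fold_count l n = 1" using assms(1) by auto
  have "j div n < 2" using j(1) by (simp add: less_mult_imp_div_less)
  moreover have "j mod n < n" using assms(2) by simp
  ultimately have "signal_vars (fold_word l i n z (j div n * n + j mod n)) \<subseteq> ext_vars (minus_formula l i n z)"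
    unfolding minus_formula_def
    using sum_minus_row_vars[of "j div n" 2 "j mod n" n "\<lambda>r j. fold_word l i n z (r * n + j)" "Minus i z"] by simp
  then show ?thesis using assms(1) j(2) by (simp add: fold_word_def acc_def fold_rows_def input_word_def)
qed

section \<open>Number of clauses\<close>

lemma length_adder: "length (adder p r lo n m A B cin) = (n - lo) + (m - lo)"
  by (simp add: adder_def Let_def)

lemma length_sum_minus: "length (sum_minus p n row R) = (R - 1) * (2 * n)"
  by (simp add: sum_minus_def length_concat length_adder comp_def sum_list_triv)

lemma length_sum_plus: "length (sum_plus p n row t R) = (R - 1) * (2 * n)"
  by (simp add: sum_plus_def length_concat length_adder comp_def sum_list_triv)

text \<open>Rounding up to full blocks adds fewer than \<open>2 * n\<close> positions, and the first
  block needs no adder. So the number of adder positions for folding is below \<open>l\<close> for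
  every \<open>n\<close>.\<close>

lemma fold_adders: "l \<ge> 1 \<Longrightarrow> n \<ge> 1 \<Longrightarrow> (fold_count l n - 1) * (2 * n) \<le> l - 1"
proof -
  have "fold_count l n * (2 * n) \<le> l + 2 * n - 1"
    unfolding fold_count_def by (rule div_times_less_eq_dividend)
  then show "(fold_count l n - 1) * (2 * n) \<le> l - 1" if "l \<ge> 1"
    using that unfolding diff_mult_distrib by linarith
qed

lemma length_residue_gates:
  assumes "l \<ge> 1" "n \<ge> 1"
  shows "real (length (residue_gates l i n)) \<le> 4 * (real l - 1) + 6 * real n ^ 2 + 10 * real n + 1"
proof -
  define R where "R = (fold_count l n - 1) * (2 * n)"
  obtain m where n: "n = Suc m" using assms(2) by (cases n) auto
  \<comment> \<open>In this order: two foldings, the halves added for two operands modulo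
    \<open>2 ^ n - 1\<close>, the same modulo \<open>2 ^ n + 1\<close>, and the two
    multipliers.\<close>
  have "length (residue_gates l i n) = 4 * R + 4 * n + 4 * n + (n * n + (n - 1) * (2 * n))
      + (n * n + 2 * n + 1 + (n + 1) * (2 * n))"
    by (simp add: residue_gates_def fold_formula_def minus_formula_def plus_formula_def mul_minus_gates_def
      mul_plus_gates_def length_sum_minus length_sum_plus length_concat comp_def sum_list_triv R_def)
  then have "real (length (residue_gates l i n)) = 4 * real R + 6 * real n ^ 2 + 10 * real n + 1"
    by (simp add: n power2_eq_square algebra_simps)
  moreover have "real R \<le> real l - 1"
    using fold_adders[OF assms] assms(1) unfolding R_def by linarith
  ultimately show ?thesis by simp
qed

lemma sum_rows: "(\<Sum>r<n. real (n - r)) = real n * (real n + 1) / 2"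
  by (induction n) (simp_all add: sum.lessThan_Suc_shift field_simps del: sum.lessThan_Suc)

lemma sum_upper_rows:
  assumes "n \<ge> 1"
  shows "(\<Sum>r=1..<n. real (n - r)) = real n * (real n - 1) / 2"
    and "(\<Sum>r=1..<n. real (n - 1 - r)) = (real n - 1) * (real n - 2) / 2"
proof -
  obtain m where n: "n = Suc m" using assms by (cases n) auto
  have first: "(\<Sum>r=1..<n. real (n - r)) = (\<Sum>r<m. real (m - r))"
    unfolding n One_nat_def sum.shift_bounds_Suc_ivl atLeast0LessThan[symmetric] by simp
  show "(\<Sum>r=1..<n. real (n - r)) = real n * (real n - 1) / 2"
    unfolding first sum_rows by (simp add: n mult.commute)
  have second: "(\<Sum>r=1..<n. real (n - 1 - r)) = (\<Sum>r<m. real (m - r) - 1)"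
    unfolding n One_nat_def sum.shift_bounds_Suc_ivl atLeast0LessThan[symmetric]
    by (intro sum.cong) (auto simp: of_nat_diff)
  show "(\<Sum>r=1..<n. real (n - 1 - r)) = (real n - 1) * (real n - 2) / 2"
    unfolding second sum_subtractf sum_rows by (simp add: n field_simps)
qed

text \<open>Three triangles: \<open>n * (n + 1) / 2\<close> bit products,
  \<open>n * (n - 1) / 2\<close> sum bits, and \<open>(n - 1) * (n - 2) / 2\<close> carries, as the
  top carry of each row is dropped.\<close>

lemma length_mul_pow_gates:
  assumes "n \<ge> 1"
  shows "real (length (mul_pow_gates l n)) = 3 / 2 * real n ^ 2 - 3 / 2 * real n + 1"
proof -
  have "length (mul_pow_gates l n) = (\<Sum>r<n. n - r) + (\<Sum>r=1..<n. (n - r) + (n - 1 - r))"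
    by (simp add: mul_pow_gates_def length_concat comp_def length_adder interv_sum_list_conv_sum_set_nat
      atLeast0LessThan)
  then have "real (length (mul_pow_gates l n)) = (\<Sum>r<n. real (n - r))
      + ((\<Sum>r=1..<n. real (n - r)) + (\<Sum>r=1..<n. real (n - 1 - r)))"
    by (simp only: of_nat_add of_nat_sum sum.distrib)
  then show ?thesis
    unfolding sum_rows sum_upper_rows[OF assms] by (simp add: power2_eq_square field_simps)
qed

lemma length_gates:
  assumes "l \<ge> 1" "\<forall>i\<le>k. e i \<ge> 1"
  shows "real (length (gates l k e)) \<le> 3 / 2 * real (e 0) ^ 2 - 3 / 2 * real (e 0) + 1
    + (\<Sum>i=1..k. 4 * (real l - 1) + 6 * real (e i) ^ 2 + 10 * real (e i) + 1)"
proof -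
  have "real (length (gates l k e)) = real (length (mul_pow_gates l (e 0)))
      + (\<Sum>i=1..k. real (length (residue_gates l i (e i))))"
    by (simp add: gates_def length_concat comp_def interv_sum_list_conv_sum_set_nat
      atLeastLessThanSuc_atLeastAtMost del: upt_Suc)
  also have "\<dots> \<le> 3 / 2 * real (e 0) ^ 2 - 3 / 2 * real (e 0) + 1
    + (\<Sum>i=1..k. 4 * (real l - 1) + 6 * real (e i) ^ 2 + 10 * real (e i) + 1)"
    using assms by (intro add_mono sum_mono length_residue_gates) (auto simp: length_mul_pow_gates)
  finally show ?thesis .
qed

lemma length_factoring_formula:
  "real (length (factoring_formula l k e x)) = real (length (gates l k e)) + real (e 0) + (\<Sum>i=1..k. 2 * real (e i))"
  by (simp add: gates_def factoring_formula_def length_concat comp_def interv_sum_list_conv_sum_set_nat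
    atLeastLessThanSuc_atLeastAtMost mul_pow_formula_eq mul_minus_formula_eq mul_plus_formula_eq
    residue_gates_def compare_pow_def compare_minus_def compare_plus_def Let_def sum.distrib sum_distrib_left
    del: upt_Suc)

section \<open>Number of clauses in conjunctive normal form\<close>

lemma and_rows_cnf:
  "expressible_as_cnf 4 (3 * real n ^ 2)
    (concat (map (\<lambda>r. map (\<lambda>j. and_gate (And p r j) (a r j) (b r j)) [0..<n]) [0..<n]))"
proof -
  have "expressible_as_cnf 4 (real (length [0..<n]) * (real (length [0..<n]) * 3))
    (concat (map (\<lambda>r. map (\<lambda>j. and_gate (And p r j) (a r j) (b r j)) [0..<n]) [0..<n]))"
    by (intro expressible_as_cnf_concat_const expressible_as_cnf_map and_gate_cnf)
  then show ?thesis by (simp add: power2_eq_square mult_ac)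
qed

lemma and_row_cnf: "expressible_as_cnf 4 (real (length xs) * 3) (map (\<lambda>j. and_gate (And p r j) (a j) (b j)) xs)"
  by (intro expressible_as_cnf_map and_gate_cnf)

lemma mul_minus_cnf:
  assumes "n \<ge> 1"
  shows "expressible_as_cnf 4 (17 * real n ^ 2 - 12 * real n) (mul_minus_formula i n x)"
proof -
  have "expressible_as_cnf 4 (3 * real n ^ 2 + 14 * real n * real (n - 1) + 2 * real n) (mul_minus_formula i n x)"
    unfolding mul_minus_formula_eq mul_minus_gates_def
    by (intro expressible_as_cnf_append and_rows_cnf sum_minus_cnf compare_minus_cnf)
  then show ?thesis
    by (rule expressible_as_cnf_mono) (use assms in \<open>simp add: of_nat_diff power2_eq_square algebra_simps\<close>)
qed

lemma mul_plus_cnf: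
  "expressible_as_cnf 4 (17 * real n ^ 2 + 22 * real n + 3) (mul_plus_formula i n x)"
proof -
  have "expressible_as_cnf 4 (3 * real n ^ 2 + real (length [0..<n]) * 3 + real (length [0..<n]) * 3
      + real (length [0 :: nat]) * 3 + 14 * real n * real (n + 2 - 1) + 2 * real n) (mul_plus_formula i n x)"
    unfolding mul_plus_formula_eq mul_plus_gates_def
    by (intro expressible_as_cnf_append and_rows_cnf and_row_cnf sum_plus_cnf compare_plus_cnf)
  then show ?thesis
    by (rule expressible_as_cnf_mono) (simp add: power2_eq_square algebra_simps)
qed

lemma residue_cnf:
  assumes "l \<ge> 1" "n \<ge> 1"
  shows "expressible_as_cnf 4 (28 * (real l - 1) + 34 * real n ^ 2 + 66 * real n + 3)
    (fold_formula l i n U @ fold_formula l i n V @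
       minus_formula l i n U @ minus_formula l i n V @ mul_minus_formula i n x @
       plus_formula l i n U @ plus_formula l i n V @ mul_plus_formula i n x)"
proof -
  \<comment> \<open>\<open>?R\<close> is the cost of folding one operand, \<open>?T\<close> that of
    one addition of halves; the former occurs twice, the latter four times.\<close>
  let ?R = "14 * real (2 * n) * real (fold_count l n - 1)" and ?T = "14 * real n * real (2 - 1)"
  have "real ((fold_count l n - 1) * (2 * n)) \<le> real l - 1"
    using fold_adders[OF assms] assms(1) by linarith
  then have R: "?R \<le> 14 * (real l - 1)" by (simp add: mult_ac)
  have "expressible_as_cnf 4
    (?R + (?R + (?T + (?T + ((17 * real n ^ 2 - 12 * real n) + (?T + (?T + (17 * real n ^ 2 + 22 * real n + 3))))))))
    (fold_formula l i n U @ fold_formula l i n V @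
       minus_formula l i n U @ minus_formula l i n V @ mul_minus_formula i n x @
       plus_formula l i n U @ plus_formula l i n V @ mul_plus_formula i n x)"
    unfolding fold_formula_def minus_formula_def plus_formula_def
    by (intro expressible_as_cnf_append sum_minus_cnf sum_plus_cnf mul_minus_cnf mul_plus_cnf assms)
  then show ?thesis by (rule expressible_as_cnf_mono) (use R in simp)
qed

lemma mul_pow_cnf:
  assumes "n \<ge> 1"
  shows "expressible_as_cnf 4 (17 / 2 * real n ^ 2 - 21 / 2 * real n + 6) (mul_pow_formula l n x)"
proof -
  have "expressible_as_cnf 4 (real (length [0..<n]) * 1) (compare_pow n x)"
    unfolding compare_pow_def
  proof (rule expressible_as_cnf_map)
    fix j
    let ?s = "acc_pow (n - 1) j"
    let ?Cs = "[[if bit x j then ?s else inv_signal ?s]]"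
    have "expressible_as_cnf 4 (real (length ?Cs)) [(signal_vars ?s, \<lambda>\<sigma>. signal_val \<sigma> ?s = bit x j)]"
      by (rule expressible_as_cnf_signals) auto
    then show "expressible_as_cnf 4 1 [(signal_vars ?s, \<lambda>\<sigma>. signal_val \<sigma> ?s = bit x j)]" by simp
  qed
  then have "expressible_as_cnf 4
    (sum_list (map (\<lambda>r. real (length [r..<n]) * 3) [0..<n])
      + sum_list (map (\<lambda>r. 8 * real (n - r) + 6 * real (n - 1 - r)) [1..<n]) + real (length [0..<n]) * 1)
    (mul_pow_formula l n x)"
    unfolding mul_pow_formula_eq mul_pow_gates_def
    by (intro expressible_as_cnf_append expressible_as_cnf_concat and_row_cnf adder_cnf)
  moreover have "sum_list (map (\<lambda>r. real (length [r..<n]) * 3) [0..<n])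
      + sum_list (map (\<lambda>r. 8 * real (n - r) + 6 * real (n - 1 - r)) [1..<n]) + real (length [0..<n]) * 1
      = 3 * (\<Sum>r<n. real (n - r)) + (8 * (\<Sum>r=1..<n. real (n - r)) + 6 * (\<Sum>r=1..<n. real (n - 1 - r))) + real n"
    by (simp only: length_upt interv_sum_list_conv_sum_set_nat set_upt atLeast0LessThan sum.distrib diff_zero
      mult_1_right mult.commute[of _ 3] flip: sum_distrib_left sum_distrib_right)
  ultimately show ?thesis
    unfolding sum_rows sum_upper_rows[OF assms]
    by (elim expressible_as_cnf_mono) (simp add: power2_eq_square field_simps)
qed

lemma factoring_formula_cnf:
  assumes "l \<ge> 1" "\<forall>i\<le>k. e i \<ge> 1"
  shows "expressible_as_cnf 4 (17 / 2 * real (e 0) ^ 2 - 21 / 2 * real (e 0) + 6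
    + (\<Sum>i=1..k. 28 * (real l - 1) + 34 * real (e i) ^ 2 + 66 * real (e i) + 3)) (factoring_formula l k e x)"
proof -
  have "expressible_as_cnf 4 (17 / 2 * real (e 0) ^ 2 - 21 / 2 * real (e 0) + 6
    + sum_list (map (\<lambda>i. 28 * (real l - 1) + 34 * real (e i) ^ 2 + 66 * real (e i) + 3) [1..<Suc k])) (factoring_formula l k e x)"
    unfolding factoring_formula_def using assms
    by (intro expressible_as_cnf_append expressible_as_cnf_concat mul_pow_cnf residue_cnf) auto
  then show ?thesis
    by (simp only: interv_sum_list_conv_sum_set_nat set_upt atLeastLessThanSuc_atLeastAtMost)
qed

theorem mainTheorem8:
  fixes l x k :: nat and e :: "nat \<Rightarrow> nat"
  assumes "l \<ge> 1"
    and "\<exists>p q. bit_prime l p \<and> bit_prime l q \<and> x = p * q"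
    and "k \<ge> 1"
    and "\<forall>i\<le>k. e i \<ge> 1"
    and "Lcm ({2 ^ e 0} \<union> (\<lambda>i. 2 ^ e i - 1) ` {1..k} \<union> (\<lambda>i. 2 ^ e i + 1) ` {1..k}) \<ge> (2 ^ (2 * l) :: nat)"
  shows "let l' = (\<lambda>i. l - l mod e i);
             N = (\<Sum>i=1..k. 6 * real (e i) ^ 2 + 19 * real (e i) + 2 * real (l' i))
                 + 3 / 2 * real (e 0) ^ 2 - 1 / 2 * real (e 0)
                 + 4 * real k * real l + real k + 2 * real l - 2;
             M = (\<Sum>i=1..k. 40 * real (e i) ^ 2 + 88 * real (e i) + 8 * real (l' i))
                 + 10 * real (e 0) ^ 2 - 6 * real (e 0)
                 + 32 * real k * real l + 8 * real k - 8;
             F = factoring_formula l k e x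
         in ext_conjunctive_form 4 F \<and>
            real (card (ext_vars F)) \<le> N \<and>
            real (length F) \<le> N \<and>
            (\<forall>z. \<forall>j<l. Input z j \<in> ext_vars F) \<and>
            (\<forall>u v. bit_number l u \<longrightarrow> bit_number l v \<longrightarrow>
               (u * v = x \<longleftrightarrow> (\<exists>\<sigma>. encodes l \<sigma> U u \<and> encodes l \<sigma> V v \<and> ext_sat \<sigma> F))) \<and>
            expressible_as_cnf 4 M F"
proof -
  define l' where "l' i = l - l mod e i" for i
  define N where "N = (\<Sum>i=1..k. 6 * real (e i) ^ 2 + 19 * real (e i) + 2 * real (l' i))
                 + 3 / 2 * real (e 0) ^ 2 - 1 / 2 * real (e 0)
                 + 4 * real k * real l + real k + 2 * real l - 2"
  define M where "M = (\<Sum>i=1..k. 40 * real (e i) ^ 2 + 88 * real (e i) + 8 * real (l' i))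
                 + 10 * real (e 0) ^ 2 - 6 * real (e 0)
                 + 32 * real k * real l + 8 * real k - 8"
  let ?F = "factoring_formula l k e x"
  let ?I = "input_cells l U \<union> input_cells l V"
  note circ = circuit_gates[OF assms(1,4)]
  note circD = circuitD[OF circ]
  have e0: "e 0 \<ge> 1" using assms(4) by simp
  have k: "real k \<ge> 1" and l: "real l \<ge> 1" using assms(1,3) by simp_all
  \<comment> \<open>The counts are compared index by index; \<open>c\<close> collects what the
    bounds \<open>N\<close> and \<open>M\<close> keep outside their sums as a multiple of
    \<open>k\<close>, notably the terms in \<open>k * l\<close>.\<close>
  have sum: "(\<Sum>i=1..k. f i) + c * real k \<le> (\<Sum>i=1..k. g i)"
    if "\<And>i. 1 \<le> real (e i) \<Longrightarrow> f i + c \<le> g i" for f g :: "nat \<Rightarrow> real" and c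
  proof -
    have "(\<Sum>i=1..k. f i + c) \<le> (\<Sum>i=1..k. g i)"
      using assms(4) by (intro sum_mono that) auto
    then show ?thesis by (simp add: sum.distrib mult.commute)
  qed

  have form: "ext_conjunctive_form 4 ?F"
    by (rule factoring_formula_form[OF circD(1)])

  have len: "real (length ?F) \<le> N"
  proof -
    have "(\<Sum>i=1..k. (4 * (real l - 1) + 6 * real (e i) ^ 2 + 10 * real (e i) + 1) + 2 * real (e i)) + (2 - 4 * real l) * real k
        \<le> (\<Sum>i=1..k. 6 * real (e i) ^ 2 + 19 * real (e i) + 2 * real (l' i))"
      by (rule sum) simp
    then show ?thesis
      using length_gates[OF assms(1,4)] k l unfolding length_factoring_formula N_def sum.distrib[of _ "\<lambda>i. 2 * real (e i)"]
      by (simp add: algebra_simps)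
  qed

  have vars: "real (card (ext_vars ?F)) \<le> N"
  proof -
    have "ext_vars ?F \<subseteq> ?I \<union> gate_cells l k e"
      by (rule factoring_formula_vars[OF circD(2) assms(4)])
    then have "card (ext_vars ?F) \<le> card (?I \<union> gate_cells l k e)"
      using circD(4) by (intro card_mono) (auto simp: input_cells_def)
    also have "\<dots> \<le> card (input_cells l U) + card (input_cells l V) + card (gate_cells l k e)"
      by (meson add_right_mono card_Un_le order_trans)
    \<comment> \<open>Each input bit is one variable and each gate defines at most one more.\<close>
    also have "\<dots> \<le> l + l + length (gates l k e)"
      using circD(5) card_image_le[of "{..<l}"] by (intro add_mono) (auto simp: input_cells_def)
    finally have "real (card (ext_vars ?F)) \<le> 2 * real l + real (length (gates l k e))" by simp
    moreover have "(\<Sum>i=1..k. 4 * (real l - 1) + 6 * real (e i) ^ 2 + 10 * real (e i) + 1) + (3 - 4 * real l) * real k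
        \<le> (\<Sum>i=1..k. 6 * real (e i) ^ 2 + 19 * real (e i) + 2 * real (l' i))"
      by (rule sum) simp
    ultimately show ?thesis
      using length_gates[OF assms(1,4)] k l e0 unfolding N_def by (simp add: algebra_simps)
  qed

  have inputs: "Input z j \<in> ext_vars ?F" if "j < l" for z j
  proof -
    let ?f = "\<lambda>i. fold_formula l i (e i) U @ fold_formula l i (e i) V @
       minus_formula l i (e i) U @ minus_formula l i (e i) V @ mul_minus_formula i (e i) x @
       plus_formula l i (e i) U @ plus_formula l i (e i) V @ mul_plus_formula i (e i) x"
    \<comment> \<open>Index 1 exists as \<open>k \<ge> 1\<close>. The part for
      \<open>2 ^ e 0\<close> would not do, as it reads only the lowest \<open>e 0\<close> bits of
      the operands.\<close>
    have "Input z j \<in> ext_vars (fold_formula l 1 (e 1) z) \<union> ext_vars (minus_formula l 1 (e 1) z)"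
      using that assms(3,4) by (intro input_in_residue) auto
    then have "Input z j \<in> ext_vars (?f 1)"
      by (cases z) (auto simp: ext_vars_append)
    moreover have "ext_vars (?f 1) \<subseteq> ext_vars ?F"
      unfolding factoring_formula_def ext_vars_append[of "mul_pow_formula l (e 0) x"] ext_vars_concat
        set_map set_upt image_image
      using assms(3) by (intro le_supI2 UN_upper) simp
    ultimately show ?thesis by (rule subsetD[rotated])
  qed

  have cnf: "expressible_as_cnf 4 M ?F"
  proof -
    have "(\<Sum>i=1..k. 28 * (real l - 1) + 34 * real (e i) ^ 2 + 66 * real (e i) + 3) + (- (32 * real l)) * real k
        \<le> (\<Sum>i=1..k. 40 * real (e i) ^ 2 + 88 * real (e i) + 8 * real (l' i))"
    proof (rule sum)
      fix i
      show "28 * (real l - 1) + 34 * real (e i) ^ 2 + 66 * real (e i) + 3 + - (32 * real l)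
          \<le> 40 * real (e i) ^ 2 + 88 * real (e i) + 8 * real (l' i)"
      proof -
        have "- 25 - 4 * real l \<le> 0" by simp
        also have "0 \<le> 22 * real (e i) + (6 * real (e i) ^ 2 + 8 * real (l' i))"
          by (intro add_nonneg_nonneg mult_nonneg_nonneg) auto
        finally show ?thesis by simp
      qed
    qed
    \<comment> \<open>The product is twice the difference of the two quadratic bounds in
      \<open>e 0\<close>, which vanishes at \<open>e 0 = 1\<close>.\<close>
    moreover have "0 \<le> (3 * real (e 0) + 12) * (real (e 0) - 1)" using e0 by simp
    then have "12 \<le> 3 * real (e 0) ^ 2 + 9 * real (e 0)"
      by (simp add: power2_eq_square algebra_simps)
    then have "17 / 2 * real (e 0) ^ 2 - 21 / 2 * real (e 0) + 6 \<le> 10 * real (e 0) ^ 2 - 6 * real (e 0)"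
      by (simp add: field_simps)
    ultimately show ?thesis
      using k by (intro expressible_as_cnf_mono[OF factoring_formula_cnf[OF assms(1,4)]])
        (simp add: M_def algebra_simps)
  qed

  have correct: "u * v = x \<longleftrightarrow> (\<exists>\<sigma>. encodes l \<sigma> U u \<and> encodes l \<sigma> V v \<and> ext_sat \<sigma> ?F)"
    if uv: "bit_number l u" "bit_number l v" for u v
  proof
    assume eq: "u * v = x"
    \<comment> \<open>Only the inputs matter; the default \<open>False\<close> on gate variables is
      overwritten by the solution of the gates.\<close>
    define \<rho> where "\<rho> y = (case y of Input U j \<Rightarrow> bit u j | Input V j \<Rightarrow> bit v j | _ \<Rightarrow> False)" for y
    obtain \<sigma> where \<sigma>: "\<forall>y. y \<notin> gate_cells l k e \<longrightarrow> \<sigma> y = \<rho> y" "ext_sat \<sigma> (gates l k e)"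
      by (rule circuit_solution[OF circ])
    have "Input z j \<notin> gate_cells l k e" if "j < l" for z j
      using that circD(3) by (cases z) (auto simp: input_cells_def)
    then have enc: "encodes l \<sigma> U u" "encodes l \<sigma> V v"
      using \<sigma>(1) by (simp_all add: encodes_def \<rho>_def)
    then show "\<exists>\<sigma>. encodes l \<sigma> U u \<and> encodes l \<sigma> V v \<and> ext_sat \<sigma> ?F"
      using factoring_formula_sat[OF \<sigma>(2) assms(1,4) enc uv, of x] eq by auto
  next
    assume "\<exists>\<sigma>. encodes l \<sigma> U u \<and> encodes l \<sigma> V v \<and> ext_sat \<sigma> ?F"
    then obtain \<sigma> where enc: "encodes l \<sigma> U u" "encodes l \<sigma> V v" and sat: "ext_sat \<sigma> ?F" by blast
    have "ext_sat \<sigma> (gates l k e)"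
      using sat by (auto simp: factoring_formula_def gates_def residue_gates_def mul_pow_formula_eq
        mul_minus_formula_eq mul_plus_formula_eq ext_sat_append ext_sat_concat)
    from factoring_formula_sat[OF this assms(1,4) enc uv, of x] sat
    have cong: "[u * v = x] (mod 2 ^ e 0)"
      "\<forall>i\<in>{1..k}. [u * v = x] (mod (2 ^ e i - 1)) \<and> [u * v = x] (mod (2 ^ e i + 1))" by auto
    \<comment> \<open>Both \<open>u * v\<close> and \<open>x\<close> are products of two
      \<open>l\<close>-bit numbers, which is why \<open>2 ^ (2 * l)\<close> is the threshold for the
      least common multiple.\<close>
    have "a * b < 2 ^ (2 * l)" if "a < 2 ^ l" "b < 2 ^ l" for a b :: nat
      using mult_strict_mono[OF that] by (simp add: mult_2 power_add)
    then have "u * v < 2 ^ (2 * l)" "x < 2 ^ (2 * l)"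
      using uv assms(2) by (auto simp: bit_number_def bit_prime_def)
    note bounds = this[THEN less_le_trans, OF assms(5)]
    show "u * v = x"
      by (rule cong_Lcm_imp_eq[OF _ bounds]) (use cong in blast)
  qed

  show ?thesis
    unfolding Let_def using form vars len inputs correct cnf unfolding N_def M_def l'_def by blast
qed


end
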